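(* Let $K$ be an algebraically closed field and set $\mathrm{GL}_{3,2}:=\mathrm{GL}_3(K)\times\mathrm{GL}_2(K)$. The $\mathrm{GL}_{3,2}$-orbits in $\mathcal{N}_{3,2}$ are the following ($7$ orbits): \begin{align*} \mathrm{GL}_{3,2}\cdot A_{0,1}&=\mathrm{GL}_3(K)\cdot\{A_{\lambda,\mu},A_{\lambda,\infty},A_{\infty,\lambda}\mid\lambda,\mu\in K,\mu\ne0\}\\ \mathrm{GL}_{3,2}\cdot B_{0,1}&=\mathrm{GL}_3(K)\cdot\{B_{\lambda,\mu},B_{\infty,\mu}\mid\lambda,\mu\in K,\mu\ne0\}\\ \mathrm{GL}_{3,2}\cdot B_{0,0}&=\mathrm{GL}_3(K)\cdot\{B_{\lambda,0},B_{\infty,0}\mid\lambda\in K\}\\ \mathrm{GL}_{3,2}\cdot C&=\mathrm{GL}_3(K)\cdot C\\ \mathrm{GL}_{3,2}\cdot D&=\mathrm{GL}_3(K)\cdot D\\ \mathrm{GL}_{3,2}\cdot E_0&=\mathrm{GL}_3(K)\cdot\{E_\lambda,E_\infty\mid\lambda\in K\}\\ \mathrm{GL}_{3,2}\cdot O&=\{O\}. \end{align*} Moreover, the edges of the Hasse diagram of the degeneration order for the $\mathrm{GL}_{3,2}$-orbits in $\mathcal{N}_{3,2}$ are exactly the following, where $X\to Y$ means that $\mathrm{GL}_{3,2}\cdot Y$ is a minimal degeneration of $\mathrm{GL}_{3,2}\cdot X$: \[A_{0,1}\to B_{0,1},\quad B_{0,1}\to B_{0,0},\quad B_{0,1}\to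 C,\quad B_{0,1}\to D,\quad B_{0,0}\to E_0,\quad C\to E_0,\quad D\to E_0,\quad E_0\to O.\]
   Context: $E_{ij}$ denotes the $3\times 3$ matrix unit with entry $1$ in position $(i,j)$ and $0$ elsewhere. $\mathrm{GL}_3(K)$ acts on $(K^{3\times 3})^2$ by simultaneous conjugation, $g\cdot(A_1,A_2)=(gA_1g^{-1},gA_2g^{-1})$. $\mathrm{GL}_2(K)$ acts by $\begin{bmatrix} g_{11} & g_{12} \\ g_{21} & g_{22} \end{bmatrix}\cdot(A_1,A_2)=(g_{11}A_1+g_{12}A_2,\ g_{21}A_1+g_{22}A_2)$. The two actions commute, giving an action of $\mathrm{GL}_3(K)\times\mathrm{GL}_2(K)$. $\mathcal{N}_{3,2}$ is the set of pairs $(A_1,A_2)\in (K^{3\times 3})^2$ such that $A_1,A_2$ generate a nilpotent (non-unital) subalgebra of $K^{3\times 3}$; it is preserved by this action. Named pairs: $A_{\lambda,\mu}=(E_{21}+E_{32},\lambda(E_{21}+E_{32})+\mu E_{32})$ ($\lambda,\mu\in K$, $\mu\ne0$); $A_{\lambda,\infty}=(E_{21},\lambda E_{21}+E_{32})$ ($\lambda\in K$); $A_{\infty,\lambda}=(E_{32},E_{21}+\lambda E_{32})$ ($\lambda\in K$); $B_{\lambda,\mu}=(E_{21}+E_{32},\lambda(E_{21}+E_{32})+\mu E_{31})$ ($\lambda,\mu\in K$); $B_{\infty,\lambda}=(\lambda E_{31},E_{21}+E_{32})$ ($\lambda\in K$); $C=(E_{21},E_{31})$; $D=(E_{31},E_{32})$;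 $E_\lambda=(E_{21},\lambda E_{21})$ ($\lambda\in K$); $E_\infty=(0,E_{21})$; $O=(0,0)$. Degeneration order on $\mathrm{GL}_{3,2}$-orbits: the orbit of $X$ degenerates to the orbit of $Y$ if $\mathrm{GL}_{3,2}\cdot Y\subseteq\overline{\mathrm{GL}_{3,2}\cdot X}$ (Zariski closure). It is a minimal degeneration if the two orbits are different and there is no third orbit $\mathrm{GL}_{3,2}\cdot Z$ such that the orbit of $X$ degenerates to that of $Z$ and the orbit of $Z$ degenerates to that of $Y$. *)

theory Defs
  imports
    "HOL-Analysis.Analysis"
    "HOL-Computational_Algebra.Polynomial"
begin

type_synonym 'k mat3 = "'k^3^3"
type_synonym 'k mat3_pair = "'k mat3 \<times> 'k mat3"

(* The distribution's scalar multiplication *s acts on vectors, and *_R needs real scalars. *)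
definition smult_mat :: "'k::times \<Rightarrow> 'k^'n^'m \<Rightarrow> 'k^'n^'m"  (infixr \<open>*\<^sub>m\<close> 75)
  where "c *\<^sub>m A = (\<chi> i j. c * A $ i $ j)"

(* Matrix unit with 1 in row i, column j.  The indices 1, 2, 3 :: 3 are pairwise distinct
   and exhaust the index type. *)
definition E :: "3 \<Rightarrow> 3 \<Rightarrow> 'k::zero_neq_one mat3"
  where "E i j = (\<chi> r c. if r = i \<and> c = j then 1 else 0)"

definition GL :: "('k::semiring_1^'n^'n) set"
  where "GL = {g. invertible g}"

definition conj_act :: "'k::field mat3 \<Rightarrow> 'k mat3_pair \<Rightarrow> 'k mat3_pair"
  where "conj_act g X = (g ** fst X ** matrix_inv g, g ** snd X ** matrix_inv g)"

definition mix_act :: "'k::field^2^2 \<Rightarrow> 'k mat3_pair \<Rightarrow> 'k mat3_pair"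
  where "mix_act h X =
    (h$1$1 *\<^sub>m fst X + h$1$2 *\<^sub>m snd X, h$2$1 *\<^sub>m fst X + h$2$2 *\<^sub>m snd X)"

definition GL3_sweep :: "'k::field mat3_pair set \<Rightarrow> 'k mat3_pair set"
  where "GL3_sweep S = {conj_act g X | g X. g \<in> GL \<and> X \<in> S}"

definition orbit32 :: "'k::field mat3_pair \<Rightarrow> 'k mat3_pair set"
  where "orbit32 X = {conj_act g (mix_act h X) | g h. g \<in> GL \<and> h \<in> GL}"

inductive_set gen_alg :: "'k::field mat3 set \<Rightarrow> 'k mat3 set" for G :: "'k mat3 set"
  where
    gen: "A \<in> G \<Longrightarrow> A \<in> gen_alg G"
  | zero: "0 \<in> gen_alg G"
  | add: "A \<in> gen_alg G \<Longrightarrow> B \<in> gen_alg G \<Longrightarrow> A + B \<in> gen_alg G"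
  | smult: "A \<in> gen_alg G \<Longrightarrow> c *\<^sub>m A \<in> gen_alg G"
  | mult: "A \<in> gen_alg G \<Longrightarrow> B \<in> gen_alg G \<Longrightarrow> A ** B \<in> gen_alg G"

(* An algebra S is nilpotent if all products of n elements of S vanish, for some n;
   n = 0 can never satisfy this since the empty product is the identity matrix. *)
definition nilpotent_alg :: "'k::field mat3 set \<Rightarrow> bool"
  where "nilpotent_alg S \<longleftrightarrow>
    (\<exists>n. \<forall>As. length As = n \<and> set As \<subseteq> S \<longrightarrow> foldr (**) As (mat 1) = 0)"

definition N32 :: "'k::field mat3_pair set"
  where "N32 = {X. nilpotent_alg (gen_alg {fst X, snd X})}"

(* Polynomial functions in the 18 matrix entries of a pair. *)
inductive poly_fun :: "('k::field mat3_pair \<Rightarrow> 'k) \<Rightarrow> bool"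
  where
    const: "poly_fun (\<lambda>X. c)"
  | coord_fst: "poly_fun (\<lambda>X. fst X $ i $ j)"
  | coord_snd: "poly_fun (\<lambda>X. snd X $ i $ j)"
  | add: "poly_fun p \<Longrightarrow> poly_fun q \<Longrightarrow> poly_fun (\<lambda>X. p X + q X)"
  | mult: "poly_fun p \<Longrightarrow> poly_fun q \<Longrightarrow> poly_fun (\<lambda>X. p X * q X)"

definition zariski_closed :: "'k::field mat3_pair set \<Rightarrow> bool"
  where "zariski_closed Z \<longleftrightarrow>
    (\<exists>P. (\<forall>p\<in>P. poly_fun p) \<and> Z = {X. \<forall>p\<in>P. p X = 0})"

definition zariski_closure :: "'k::field mat3_pair set \<Rightarrow> 'k mat3_pair set"
  where "zariski_closure S = zariski_closed hull S"

definition degenerates :: "'k::field mat3_pair \<Rightarrow> 'k mat3_pair \<Rightarrow> bool"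
  where "degenerates X Y \<longleftrightarrow> orbit32 Y \<subseteq> zariski_closure (orbit32 X)"

definition minimal_degeneration :: "'k::field mat3_pair \<Rightarrow> 'k mat3_pair \<Rightarrow> bool"
  where "minimal_degeneration X Y \<longleftrightarrow>
    degenerates X Y \<and> orbit32 X \<noteq> orbit32 Y \<and>
    \<not> (\<exists>Z. orbit32 Z \<noteq> orbit32 X \<and> orbit32 Z \<noteq> orbit32 Y \<and>
           degenerates X Z \<and> degenerates Z Y)"

(* Suffixes: _fi has its second index infinite, _if its first. *)

definition pA :: "'k::field \<Rightarrow> 'k \<Rightarrow> 'k mat3_pair"
  where "pA l m = (E 2 1 + E 3 2, l *\<^sub>m (E 2 1 + E 3 2) + m *\<^sub>m E 3 2)"

definition pA_fi :: "'k::field \<Rightarrow> 'k mat3_pair"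
  where "pA_fi l = (E 2 1, l *\<^sub>m E 2 1 + E 3 2)"

definition pA_if :: "'k::field \<Rightarrow> 'k mat3_pair"
  where "pA_if l = (E 3 2, E 2 1 + l *\<^sub>m E 3 2)"

definition pB :: "'k::field \<Rightarrow> 'k \<Rightarrow> 'k mat3_pair"
  where "pB l m = (E 2 1 + E 3 2, l *\<^sub>m (E 2 1 + E 3 2) + m *\<^sub>m E 3 1)"

definition pB_if :: "'k::field \<Rightarrow> 'k mat3_pair"
  where "pB_if l = (l *\<^sub>m E 3 1, E 2 1 + E 3 2)"

definition pC :: "'k::field mat3_pair"
  where "pC = (E 2 1, E 3 1)"

definition pD :: "'k::field mat3_pair"
  where "pD = (E 3 1, E 3 2)"

definition pE :: "'k::field \<Rightarrow> 'k mat3_pair"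
  where "pE l = (E 2 1, l *\<^sub>m E 2 1)"

definition pE_inf :: "'k::field mat3_pair"
  where "pE_inf = (0, E 2 1)"

definition pO :: "'k::field mat3_pair"
  where "pO = (0, 0)"

end

theory Submission
  imports Defs
begin

text \<open>
  A pair generating a nilpotent algebra can be conjugated so that both matrices are strictly lower
  triangular: unless both are zero, a longest nonvanishing word \<open>W\<close> in them is killed by them on either
  side, so a nonzero column of \<open>W\<close> is a common kernel vector, a nonzero row of \<open>W\<close> is a common left
  kernel vector, and the two are orthogonal because \<open>W ** W = 0\<close>.  They determine a complete flag
  adapted to both matrices (\<open>words_vanish_similar_tri\<close>).

  Write \<open>tri a b c\<close> for the strictly lower triangular matrix with subdiagonal \<open>(a, b)\<close> and corner
  \<open>c\<close>.  For a pair of these, everything depends on the space that the two coordinate vectors span.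
  If the subdiagonals are independent, a unipotent conjugation clears the corners, and the pair lies in
  the orbit of \<open>A\<^sub>0\<^sub>,\<^sub>1\<close>.  Otherwise mixing reduces the second matrix to a multiple of
  \<open>E\<^sub>3\<^sub>1\<close>, and which of the numbers left are zero decides among the other six orbits
  (\<open>tri_pair_cases\<close>).  Normalising the pairs \<open>h \<cdot> X\<close> for each representative \<open>X\<close> by
  lower triangular conjugations gives the decomposition into \<open>GL\<^sub>3\<close>-orbits.

  A degeneration is obtained from a line \<open>U + t V\<close> whose points with \<open>t \<noteq> 0\<close> lie in the orbit of
  \<open>X\<close>: a polynomial vanishing on this orbit restricts to a univariate polynomial with infinitely many
  zeros, so that it vanishes at \<open>U\<close> too (\<open>degenerates_line\<close>).  Each of the eight edges comes from such
  a line.  Nondegenerations follow from polynomial equations satisfied on an orbit: commuting matrices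
  for \<open>B\<^sub>0\<^sub>,\<^sub>1\<close>, proportional matrices for \<open>B\<^sub>0\<^sub>,\<^sub>0\<close>, a common row space of
  dimension one for \<open>C\<close>, a common column space of dimension one for \<open>D\<close>, and vanishing for \<open>O\<close>.

  The resulting order is graded with levels \<open>A | B\<^sub>0\<^sub>,\<^sub>1 | B\<^sub>0\<^sub>,\<^sub>0, C, D | E | O\<close>, and
  any orbit degenerates to any orbit of a lower level (\<open>degenerates_rep_iff\<close>).  Hence the edges of the
  Hasse diagram are the pairs on consecutive levels.  Every orbit between two of these is again nilpotent,
  because the vanishing of all words of length three is a closed condition, so that every degeneration of a
  nilpotent pair inherits it (\<open>degenerates_from_rep\<close>).
\<close>

section \<open>The two group actions\<close>

lemma smult_mat_nth [simp]: "(c *\<^sub>m A) $ i $ j = c * A $ i $ j"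
  by (simp add: smult_mat_def)

lemma mat3_eq_iff: "(A::'k^3^3) = B \<longleftrightarrow> (\<forall>i j. A $ i $ j = B $ i $ j)"
  by (simp add: vec_eq_iff)

lemma matrix_mult_nth: "(A ** B) $ i $ j = (\<Sum>k\<in>UNIV. A $ i $ k * B $ k $ j)"
  by (simp add: matrix_matrix_mult_def)

lemma smult_mat_mult_left: "(c *\<^sub>m A) ** B = c *\<^sub>m (A ** (B::'k::comm_semiring_1^'n^'m))"
  by (simp add: vec_eq_iff matrix_mult_nth sum_distrib_left mult_ac)

lemma smult_mat_mult_right: "A ** (c *\<^sub>m B) = c *\<^sub>m (A ** (B::'k::comm_semiring_1^'n^'m))"
  by (simp add: vec_eq_iff matrix_mult_nth sum_distrib_left mult_ac)

lemma smult_mat_smult_mat: "a *\<^sub>m b *\<^sub>m A = (a * b) *\<^sub>m (A::'k::comm_semiring_1^'n^'m)"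
  by (simp add: vec_eq_iff mult_ac)

lemma matrix_add_rdistrib: "(A + B) ** C = A ** C + B ** (C::'k::comm_semiring_1^'n^'m)"
  by (simp add: vec_eq_iff matrix_mult_nth sum.distrib distrib_right)

lemma smult_mat_add: "c *\<^sub>m (A + B) = c *\<^sub>m A + c *\<^sub>m (B::'k::comm_semiring_1^'n^'m)"
  by (simp add: vec_eq_iff distrib_left)

lemmas mat_alg = smult_mat_mult_left smult_mat_mult_right smult_mat_smult_mat
  matrix_add_ldistrib matrix_add_rdistrib smult_mat_add

text \<open>
  Stated with an intertwining matrix instead of an inverse, so that similarity of explicit pairs is a matter
  of polynomial identities between entries.
\<close>

definition similar :: "'k::field mat3_pair \<Rightarrow> 'k mat3_pair \<Rightarrow> bool"
  where "similar X Y \<longleftrightarrow>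
    (\<exists>g. invertible g \<and> g ** fst X = fst Y ** g \<and> g ** snd X = snd Y ** g)"

lemma matrix_inv_cancel:
  assumes "invertible (g :: 'k::field^'n^'n)"
  shows "g ** matrix_inv g = mat 1" "matrix_inv g ** g = mat 1"
  using someI_ex[OF assms[unfolded invertible_def]] by (auto simp: matrix_inv_def)

lemma conj_eq_iff:
  assumes "invertible (g :: 'k::field^'n^'n)"
  shows "g ** A ** matrix_inv g = B \<longleftrightarrow> g ** A = B ** g"
proof
  assume "g ** A ** matrix_inv g = B"
  then have "B ** g = g ** A ** (matrix_inv g ** g)" by (simp add: matrix_mul_assoc)
  then show "g ** A = B ** g" by (simp add: matrix_inv_cancel[OF assms])
next
  assume "g ** A = B ** g"
  then have "g ** A ** matrix_inv g = B ** (g ** matrix_inv g)" by (simp add: matrix_mul_assoc)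
  then show "g ** A ** matrix_inv g = B" by (simp add: matrix_inv_cancel[OF assms])
qed

lemma similar_iff_conj_act: "similar X Y \<longleftrightarrow> (\<exists>g\<in>GL. conj_act g X = Y)"
  by (auto simp: similar_def GL_def conj_act_def prod_eq_iff conj_eq_iff)

lemma in_GL3_sweep_iff: "Y \<in> GL3_sweep S \<longleftrightarrow> (\<exists>X\<in>S. similar X Y)"
  by (auto simp: GL3_sweep_def similar_iff_conj_act)

lemma similar_refl: "similar X X"
  unfolding similar_def by (rule exI[of _ "mat 1"]) (auto simp: invertible_def)

lemma similar_sym: "similar X Y \<Longrightarrow> similar Y X"
proof -
  assume "similar X Y"
  then obtain g where g: "invertible g" "g ** fst X = fst Y ** g" "g ** snd X = snd Y ** g"
    by (auto simp: similar_def)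
  then obtain g' where g': "g ** g' = mat 1" "g' ** g = mat 1"
    by (auto simp: invertible_def)
  have "g' ** B = A ** g'" if "g ** A = B ** g" for A B :: "'a mat3"
  proof -
    have "g' ** B = g' ** (B ** g) ** g'"
      by (metis g'(1) matrix_mul_assoc matrix_mul_rid)
    also have "\<dots> = A ** g'"
      by (metis that g'(2) matrix_mul_assoc matrix_mul_lid)
    finally show ?thesis .
  qed
  moreover have "invertible g'" using g' by (auto simp: invertible_def)
  ultimately show "similar Y X" using g unfolding similar_def by blast
qed

lemma similar_trans: "similar X Y \<Longrightarrow> similar Y Z \<Longrightarrow> similar X Z"
proof -
  assume "similar X Y" "similar Y Z"
  then obtain g h where g: "invertible g" "g ** fst X = fst Y ** g" "g ** snd X = snd Y ** g"
    and h: "invertible h" "h ** fst Y = fst Z ** h" "h ** snd Y = snd Z ** h"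
    by (auto simp: similar_def)
  have "h ** g ** A = C ** (h ** g)" if "g ** A = B ** g" "h ** B = C ** h" for A B C :: "'a mat3"
    using that by (metis matrix_mul_assoc)
  then show ?thesis
    using g h unfolding similar_def by (blast intro: invertible_mult)
qed

lemma similar_mix_act: "similar X Y \<Longrightarrow> similar (mix_act h X) (mix_act h Y)"
  unfolding similar_def by (auto simp: mix_act_def mat_alg)

lemma mix_act_mat_1: "mix_act (mat 1) X = X"
  by (simp add: mix_act_def mat_def prod_eq_iff vec_eq_iff)

lemma mix_act_mix_act: "mix_act h (mix_act k X) = mix_act (h ** k) X"
  by (simp add: mix_act_def prod_eq_iff vec_eq_iff matrix_mult_nth sum_2 algebra_simps)

text \<open>
  The two actions commute, so an orbit can be explored by mixing first and conjugating afterwards.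
\<close>

lemma in_orbit32_iff:
  "Y \<in> orbit32 X \<longleftrightarrow> (\<exists>h. invertible h \<and> similar (mix_act h X) Y)"
  by (auto simp: orbit32_def similar_iff_conj_act GL_def)

lemma orbit32_similar: "similar X Y \<Longrightarrow> Y \<in> orbit32 X"
  unfolding in_orbit32_iff
  by (rule exI[of _ "mat 1"]) (auto simp: invertible_def mix_act_mat_1)

lemma orbit32_mix: "invertible h \<Longrightarrow> mix_act h X \<in> orbit32 X"
  unfolding in_orbit32_iff using similar_refl by blast

lemma orbit32_refl: "X \<in> orbit32 X"
  by (rule orbit32_similar[OF similar_refl])

lemma orbit32_sym: "Y \<in> orbit32 X \<Longrightarrow> X \<in> orbit32 Y"
proof -
  assume "Y \<in> orbit32 X"
  then obtain h where h: "invertible h" "similar (mix_act h X) Y"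
    by (auto simp: in_orbit32_iff)
  then obtain h' where h': "h ** h' = mat 1" "h' ** h = mat 1"
    by (auto simp: invertible_def)
  have "similar (mix_act h' Y) (mix_act h' (mix_act h X))"
    using h(2) by (blast intro: similar_mix_act similar_sym)
  then have "similar (mix_act h' Y) X"
    by (simp add: mix_act_mix_act h' mix_act_mat_1)
  moreover have "invertible h'" using h' by (auto simp: invertible_def)
  ultimately show ?thesis by (auto simp: in_orbit32_iff)
qed

lemma orbit32_trans: "Y \<in> orbit32 X \<Longrightarrow> Z \<in> orbit32 Y \<Longrightarrow> Z \<in> orbit32 X"
proof -
  assume "Y \<in> orbit32 X" "Z \<in> orbit32 Y"
  then obtain h k where "invertible h" "similar (mix_act h X) Y"
    "invertible k" "similar (mix_act k Y) Z"
    by (auto simp: in_orbit32_iff)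
  then have "invertible (k ** h)" "similar (mix_act (k ** h) X) Z"
    using similar_mix_act[of "mix_act h X" Y k] similar_trans[of _ "mix_act k Y"]
    by (auto simp: mix_act_mix_act invertible_mult)
  then show ?thesis by (auto simp: in_orbit32_iff)
qed

lemma orbit32_eqI: "Y \<in> orbit32 X \<Longrightarrow> orbit32 Y = orbit32 X"
  using orbit32_sym orbit32_trans by blast

section \<open>Strictly lower triangular pairs\<close>

definition tri :: "'k::field \<Rightarrow> 'k \<Rightarrow> 'k \<Rightarrow> 'k mat3"
  where "tri a b c = a *\<^sub>m E 2 1 + b *\<^sub>m E 3 2 + c *\<^sub>m E 3 1"

lemma tri_nth [simp]:
  "tri a b c $ 1 $ j = 0"
  "tri a b c $ 2 $ 1 = a" "tri a b c $ 2 $ 2 = 0" "tri a b c $ 2 $ 3 = 0"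
  "tri a b c $ 3 $ 1 = c" "tri a b c $ 3 $ 2 = b" "tri a b c $ 3 $ 3 = 0"
  by (simp_all add: tri_def E_def)

lemma representatives_tri:
  "pA l m = (tri 1 1 0, tri l (l + m) 0)"
  "pA_fi l = (tri 1 0 0, tri l 1 0)"
  "pA_if l = (tri 0 1 0, tri 1 l 0)"
  "pB l m = (tri 1 1 0, tri l l m)"
  "pB_if l = (tri 0 0 l, tri 1 1 0)"
  "pC = (tri 1 0 0, tri 0 0 1)"
  "pD = (tri 0 0 1, tri 0 1 0)"
  "pE l = (tri 1 0 0, tri l 0 0)"
  "pE_inf = (tri 0 0 0, tri 1 0 0)"
  "pO = (tri 0 0 0, tri 0 0 0)"
  by (simp_all add: pA_def pA_fi_def pA_if_def pB_def pB_if_def pC_def pD_def pE_def pE_inf_def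
      pO_def tri_def E_def vec_eq_iff)

lemma tri_add: "tri a b c + tri a' b' c' = tri (a + a') (b + b') (c + c')"
  by (simp add: mat3_eq_iff forall_3)

lemma smult_tri: "k *\<^sub>m tri a b c = tri (k * a) (k * b) (k * c)"
  by (simp add: mat3_eq_iff forall_3)

lemma tri_mult_3: "tri a b c ** tri a' b' c' = (b * a') *\<^sub>m E 3 1"
  by (simp add: mat3_eq_iff forall_3 matrix_mult_nth sum_3 E_def)

lemma invertible_mat2:
  "p * s - q * r \<noteq> 0 \<Longrightarrow> invertible (vector [vector [p, q], vector [r, s]] :: 'k::field^2^2)"
  by (simp add: invertible_det_nz det_2)

lemma mix_act_tri:
  "mix_act (vector [vector [p, q], vector [r, s]]) (tri a b c, tri a' b' c') =
    (tri (p * a + q * a') (p * b + q * b') (p * c + q * c'),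
     tri (r * a + s * a') (r * b + s * b') (r * c + s * c'))"
  by (simp add: mix_act_def smult_tri tri_add)

lemma mix_act_tri_ex: "\<exists>a b c a' b' c'. mix_act h (tri u v w, tri u' v' w') =
    (tri a b c, tri a' b' c')"
  by (auto simp: mix_act_def smult_tri tri_add)

text \<open>
  A row-major constructor with evaluation rules for its entries, so that conjugating matrices can be
  written down explicitly and checked by simplification.
\<close>

definition mat3 :: "'k::zero \<Rightarrow> 'k \<Rightarrow> 'k \<Rightarrow> 'k \<Rightarrow> 'k \<Rightarrow> 'k \<Rightarrow> 'k \<Rightarrow> 'k \<Rightarrow> 'k \<Rightarrow> 'k^3^3"
  where "mat3 p q r s t u v w z = vector [vector [p, q, r], vector [s, t, u], vector [v, w, z]]"

lemma mat3_nth [simp]: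
  "mat3 p q r s t u v w z $ 1 $ 1 = p" "mat3 p q r s t u v w z $ 1 $ 2 = q"
  "mat3 p q r s t u v w z $ 1 $ 3 = r" "mat3 p q r s t u v w z $ 2 $ 1 = s"
  "mat3 p q r s t u v w z $ 2 $ 2 = t" "mat3 p q r s t u v w z $ 2 $ 3 = u"
  "mat3 p q r s t u v w z $ 3 $ 1 = v" "mat3 p q r s t u v w z $ 3 $ 2 = w"
  "mat3 p q r s t u v w z $ 3 $ 3 = z"
  by (simp_all add: mat3_def)

text \<open>
  The equations of the second assumption are the entries of \<open>g ** tri a b c = tri a' b' c' ** g\<close>;
  quantifying over the two coordinate tuples states them once for both matrices of the pair.
\<close>

lemma similar_tri:
  assumes "p * (t * z - u * w) - q * (s * z - u * v) + r * (s * w - t * v) \<noteq> 0"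
    and "\<And>a b c a' b' c'. (a, b, c, a', b', c') \<in> {(a1, b1, c1, a2, b2, c2), (a1', b1', c1', a2', b2', c2')} \<Longrightarrow>
      q * a + r * c = 0 \<and> r * b = 0 \<and> t * a + u * c = a' * p \<and> u * b = a' * q \<and> a' * r = 0 \<and>
      w * a + z * c = c' * p + b' * s \<and> z * b = c' * q + b' * t \<and> c' * r + b' * u = 0"
  shows "similar (tri a1 b1 c1, tri a1' b1' c1') (tri a2 b2 c2, tri a2' b2' c2')"
proof -
  let ?g = "mat3 p q r s t u v w z"
  have "invertible ?g"
    using assms(1) by (simp add: invertible_det_nz det_3 algebra_simps)
  moreover have "?g ** tri a1 b1 c1 = tri a2 b2 c2 ** ?g"
    using assms(2)[of a1 b1 c1 a2 b2 c2] by (simp add: mat3_eq_iff forall_3 matrix_mult_nth sum_3)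
  moreover have "?g ** tri a1' b1' c1' = tri a2' b2' c2' ** ?g"
    using assms(2)[of a1' b1' c1' a2' b2' c2'] by (simp add: mat3_eq_iff forall_3 matrix_mult_nth sum_3)
  ultimately show ?thesis unfolding similar_def fst_conv snd_conv by blast
qed

text \<open>
  Conjugation by the unipotent matrix with subdiagonal \<open>(-x, -y)\<close> adds \<open>b x - a y\<close> to the corner
  of \<open>tri a b c\<close>.  As the two subdiagonals are independent, Cramer's rule produces \<open>x\<close> and \<open>y\<close> that
  realise any prescribed pair of corners; the subdiagonals themselves are reached by mixing.
\<close>

lemma tri_pair_in_orbit_A:
  assumes "a * b' - b * a' \<noteq> 0"
  shows "(tri a b c, tri a' b' c') \<in> orbit32 (pA 0 1)"
proof -
  let ?h = "vector [vector [a, b - a], vector [a', b' - a']] :: 'a^2^2"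
  have "(tri a b 0, tri a' b' 0) = mix_act ?h (pA 0 1)"
    by (simp add: representatives_tri mix_act_tri)
  moreover have "invertible ?h"
    by (rule invertible_mat2) (use assms in \<open>simp add: algebra_simps\<close>)
  ultimately have 1: "(tri a b 0, tri a' b' 0) \<in> orbit32 (pA 0 1)"
    using orbit32_mix by metis
  define d where "d = a * b' - b * a'"
  have d: "d \<noteq> 0" using assms d_def by simp
  define x where "x = (a * c' - a' * c) / d"
  define y where "y = (b * c' - b' * c) / d"
  have "a * y - b * x = - (c * d) / d" "a' * y - b' * x = - (c' * d) / d"
    unfolding x_def y_def times_divide_eq_right diff_divide_distrib[symmetric]
    by (simp_all add: d_def algebra_simps)
  then have xy: "a * y - b * x = - c" "a' * y - b' * x = - c'" using d by simp_all
  have "similar (tri a b 0, tri a' b' 0) (tri a b c, tri a' b' c')"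
    by (rule similar_tri[where p = 1 and q = 0 and r = 0 and s = "-x" and t = 1 and u = 0
          and v = 0 and w = "-y" and z = 1]) (use xy in \<open>auto simp: algebra_simps\<close>)
  then show ?thesis using 1 orbit32_similar orbit32_trans by blast
qed

text \<open>
  The columns of the conjugating matrix are \<open>e\<close>, \<open>N e\<close> and \<open>N (N e)\<close> for \<open>N = tri a b c\<close> and
  \<open>e\<close> the first unit vector: a Jordan basis of the regular nilpotent matrix \<open>N\<close>.  In it \<open>N ** N\<close>,
  which is \<open>a * b\<close> times \<open>E 3 1\<close>, becomes \<open>E 3 1\<close>.
\<close>

lemma similar_B:
  assumes "a \<noteq> 0" "b \<noteq> 0"
  shows "similar (tri 1 1 0, tri l l k) (tri a b c, tri (l * a) (l * b) (l * c + k * (a * b)))"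
  by (rule similar_tri[where p = 1 and q = 0 and r = 0 and s = 0 and t = a and u = 0
        and v = 0 and w = c and z = "a * b"]) (use assms in \<open>auto simp: algebra_simps\<close>)

lemma tri_pair_in_orbit_B1:
  assumes "a \<noteq> 0" "b \<noteq> 0" "c' \<noteq> 0"
  shows "(tri a b c, tri 0 0 c') \<in> orbit32 (pB 0 1)"
proof -
  let ?k = "c' / (a * b)"
  let ?h = "vector [vector [1, 0], vector [0, ?k]] :: 'a^2^2"
  have "mix_act ?h (pB 0 1) = (tri 1 1 0, tri 0 0 ?k)"
    by (simp add: representatives_tri mix_act_tri)
  moreover have "invertible ?h"
    by (rule invertible_mat2) (use assms in simp)
  moreover have "similar (tri 1 1 0, tri 0 0 ?k) (tri a b c, tri 0 0 c')"
    using similar_B[OF assms(1,2), of 0 ?k c] assms by simp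
  ultimately show ?thesis unfolding in_orbit32_iff by metis
qed

lemma tri_pair_in_orbit_B0:
  assumes "a \<noteq> 0" "b \<noteq> 0"
  shows "(tri a b c, tri 0 0 0) \<in> orbit32 (pB 0 0)"
  using similar_B[OF assms, of 0 0 c] by (simp add: representatives_tri orbit32_similar)

lemma tri_pair_in_orbit_C:
  assumes "a * c' - c * a' \<noteq> 0"
  shows "(tri a 0 c, tri a' 0 c') \<in> orbit32 pC"
proof -
  let ?h = "vector [vector [a, c], vector [a', c']] :: 'a^2^2"
  have "(tri a 0 c, tri a' 0 c') = mix_act ?h pC"
    by (simp add: representatives_tri mix_act_tri)
  then show ?thesis using orbit32_mix[OF invertible_mat2[OF assms]] by metis
qed

lemma tri_pair_in_orbit_D:
  assumes "c * b' - b * c' \<noteq> 0"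
  shows "(tri 0 b c, tri 0 b' c') \<in> orbit32 pD"
proof -
  let ?h = "vector [vector [c, b], vector [c', b']] :: 'a^2^2"
  have "(tri 0 b c, tri 0 b' c') = mix_act ?h pD"
    by (simp add: representatives_tri mix_act_tri)
  then show ?thesis using orbit32_mix[OF invertible_mat2[OF assms]] by metis
qed

text \<open>
  For \<open>a * b = 0\<close> the nonzero matrix \<open>tri a b c\<close> has rank one and square zero, hence is conjugate to
  \<open>E 2 1\<close>.  In each case the second column of the conjugating matrix is the image of the first one, and
  its third column completes the second to a basis of the kernel.
\<close>

lemma tri_pair_in_orbit_E:
  assumes "a \<noteq> 0 \<or> b \<noteq> 0 \<or> c \<noteq> 0" "a * b = 0"
  shows "(tri a b c, tri 0 0 0) \<in> orbit32 (pE 0)"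
proof (rule orbit32_similar, unfold representatives_tri)
  show "similar (tri 1 0 0, tri 0 0 0) (tri a b c, tri 0 0 0)"
  proof (cases "b = 0")
    case True
    show ?thesis
    proof (cases "a = 0")
      case True
      with \<open>b = 0\<close> assms show ?thesis
        by (intro similar_tri[where p = 1 and q = 0 and r = 0 and s = 0 and t = a and u = 1
          and v = 0 and w = c and z = 0]) auto
    next
      case False
      with \<open>b = 0\<close> assms show ?thesis
        by (intro similar_tri[where p = 1 and q = 0 and r = 0 and s = 0 and t = a and u = 0
          and v = 0 and w = c and z = 1]) auto
    qed
  next
    case False
    with assms show ?thesis
      by (intro similar_tri[where p = 0 and q = 0 and r = b and s = 1 and t = 0 and u = "-c"
        and v = 0 and w = b and z = 0]) auto
  qed
qed

text \<open>
  Dependent subdiagonals are cleared from the second matrix by a row operation.  The pair is then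
  \<open>(tri p q r, tri 0 0 s)\<close>, and the zero pattern of \<open>p\<close>, \<open>q\<close>, \<open>r\<close>, \<open>s\<close> decides the orbit.
\<close>

lemma tri_pair_cases:
  fixes a b c a' b' c' :: "'k::field"
  defines "X \<equiv> (tri a b c, tri a' b' c')"
  shows "\<exists>R\<in>{pA 0 1, pB 0 1, pB 0 0, pC, pD, pE 0, pO}. X \<in> orbit32 R"
proof (cases "a * b' - b * a' = 0")
  case False
  then show ?thesis using tri_pair_in_orbit_A unfolding X_def by blast
next
  case True
  then have det0: "a * b' = b * a'" by simp
  have "\<exists>h p q r s. invertible h \<and> mix_act h X = (tri p q r, tri 0 0 s)"
  proof (cases "a = 0 \<and> b = 0")
    case True
    show ?thesis
      by (rule exI[of _ "vector [vector [0, 1], vector [1, 0]]"])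
        (use True in \<open>auto simp: X_def mix_act_tri invertible_mat2\<close>)
  next
    case False
    then obtain k where k: "a' = k * a" "b' = k * b"
    proof (cases "a = 0")
      case True
      with False that[of "b' / b"] det0 show ?thesis by (simp add: field_simps)
    next
      case False
      with that[of "a' / a"] det0 show ?thesis by (simp add: field_simps)
    qed
    show ?thesis
      by (rule exI[of _ "vector [vector [1, 0], vector [-k, 1]]"])
        (use k in \<open>auto simp: X_def mix_act_tri invertible_mat2\<close>)
  qed
  then obtain h p q r s where h: "invertible h" and Y: "mix_act h X = (tri p q r, tri 0 0 s)"
    by blast
  then have XY: "X \<in> orbit32 (tri p q r, tri 0 0 s)"
    using orbit32_mix orbit32_sym by metis
  have "\<exists>R\<in>{pA 0 1, pB 0 1, pB 0 0, pC, pD, pE 0, pO}. (tri p q r, tri 0 0 s) \<in> orbit32 R"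
  proof (cases "s = 0")
    case True
    consider "p \<noteq> 0" "q \<noteq> 0" | "p * q = 0" "p \<noteq> 0 \<or> q \<noteq> 0 \<or> r \<noteq> 0" | "p = 0" "q = 0" "r = 0"
      by force
    then show ?thesis
    proof cases
      case 3
      then show ?thesis using True orbit32_refl[of "pO :: 'k mat3_pair"] by (simp add: representatives_tri(10))
    qed (use True tri_pair_in_orbit_B0[of p q r] tri_pair_in_orbit_E[of p q r] in auto)
  next
    case False
    consider "p \<noteq> 0" "q \<noteq> 0" | "p \<noteq> 0" "q = 0" | "p = 0" "q \<noteq> 0" | "p = 0" "q = 0"
      by blast
    then show ?thesis
    proof cases
      case 4
      let ?h = "vector [vector [0, 1], vector [1, -r / s]] :: 'k^2^2"
      have "mix_act ?h (tri p q r, tri 0 0 s) = (tri 0 0 s, tri 0 0 0)"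
        using 4 False by (simp add: mix_act_tri)
      moreover have "invertible ?h" by (rule invertible_mat2) simp
      ultimately have "(tri p q r, tri 0 0 s) \<in> orbit32 (tri 0 0 s, tri 0 0 0)"
        using orbit32_mix orbit32_sym by metis
      moreover have "(tri 0 0 s, tri 0 0 0) \<in> orbit32 (pE 0)"
        using False by (intro tri_pair_in_orbit_E) auto
      ultimately show ?thesis using orbit32_trans by blast
    qed (use False tri_pair_in_orbit_B1[of p q s r] tri_pair_in_orbit_C[of p s r 0] tri_pair_in_orbit_D[of r 0 q s] in auto)
  qed
  then show ?thesis using XY orbit32_trans by blast
qed

section \<open>Orbits as unions of conjugacy classes\<close>

lemma orbit32_eq_GL3_sweepI:
  assumes "\<And>p q r s. p * s - q * r \<noteq> 0 \<Longrightarrow>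
      \<exists>Y\<in>S. similar Y (mix_act (vector [vector [p, q], vector [r, s]]) X)"
    and "S \<subseteq> orbit32 X"
  shows "orbit32 X = GL3_sweep S"
proof (intro equalityI subsetI)
  fix Z assume "Z \<in> orbit32 X"
  then obtain h where h: "invertible h" "similar (mix_act h X) Z"
    by (auto simp: in_orbit32_iff)
  have eq: "h = vector [vector [h$1$1, h$1$2], vector [h$2$1, h$2$2]]"
    by (simp add: vec_eq_iff forall_2)
  have "h$1$1 * h$2$2 - h$1$2 * h$2$1 \<noteq> 0"
    using h(1) by (simp add: invertible_det_nz det_2)
  from assms(1)[OF this] eq obtain Y where "Y \<in> S" "similar Y (mix_act h X)" by metis
  with h(2) show "Z \<in> GL3_sweep S"
    unfolding in_GL3_sweep_iff by (blast intro: similar_trans)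
next
  fix Z assume "Z \<in> GL3_sweep S"
  then obtain Y where "Y \<in> S" "similar Y Z"
    unfolding in_GL3_sweep_iff by blast
  then show "Z \<in> orbit32 X"
    using assms(2) orbit32_similar orbit32_trans by blast
qed

lemma similar_diag:
  assumes "x \<noteq> 0" "y \<noteq> 0"
  shows "similar (tri a b c, tri a' b' c')
    (tri (x * a) (y * b) (x * y * c), tri (x * a') (y * b') (x * y * c'))"
  by (rule similar_tri[where p = 1 and q = 0 and r = 0 and s = 0 and t = x and u = 0
        and v = 0 and w = 0 and z = "x * y"]) (use assms in \<open>auto simp: algebra_simps\<close>)

text \<open>
  Mixing \<open>A\<^sub>0\<^sub>,\<^sub>1\<close> gives all pairs with independent subdiagonals and zero corners, and diagonal
  conjugation scales the two subdiagonal positions independently.  The three families of named pairs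
  record whether the first matrix has a full subdiagonal or lacks its second or first entry.
\<close>

lemma orbit32_A_eq: "orbit32 (pA 0 1 :: 'k::field mat3_pair) =
    GL3_sweep ({pA l m | l m. m \<noteq> 0} \<union> {pA_fi l | l. True} \<union> {pA_if l | l. True})"
    (is "_ = GL3_sweep ?S")
proof (rule orbit32_eq_GL3_sweepI)
  fix p q r s :: 'k
  assume det: "p * s - q * r \<noteq> 0"
  let ?b = "p + q" and ?b' = "r + s"
  consider "p = 0" | "?b = 0" | "p \<noteq> 0" "?b \<noteq> 0" by blast
  then have "\<exists>Y\<in>?S. similar Y (tri p ?b 0, tri r ?b' 0)"
  proof cases
    case 1
    then have "r \<noteq> 0" "q \<noteq> 0" using det by auto
    have "similar (pA_if (?b' / q)) (tri p ?b 0, tri r ?b' 0)"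
      using similar_diag[OF \<open>r \<noteq> 0\<close> \<open>q \<noteq> 0\<close>, of 0 1 0 1 "?b' / q" 0] 1 \<open>q \<noteq> 0\<close>
      by (simp add: representatives_tri)
    then show ?thesis by blast
  next
    case 2
    have nz: "p \<noteq> 0" using det 2 by (auto simp: add_eq_0_iff)
    have "p * ?b' \<noteq> 0" using det 2 by (simp add: algebra_simps add_eq_0_iff)
    then have nz': "?b' \<noteq> 0" by simp
    have "similar (pA_fi (r / p)) (tri p ?b 0, tri r ?b' 0)"
      using similar_diag[OF nz nz', of 1 0 0 "r / p" 1 0] 2 nz
      by (simp add: representatives_tri)
    then show ?thesis by blast
  next
    case 3
    define m where "m = ?b' / ?b - r / p"
    have "m = (p * s - q * r) / (p * ?b)"
      using 3 by (simp add: m_def divide_simps) (simp add: algebra_simps)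
    then have "m \<noteq> 0" using 3 det by simp
    moreover have "similar (pA (r / p) m) (tri p ?b 0, tri r ?b' 0)"
      using similar_diag[OF 3, of 1 1 0 "r / p" "?b' / ?b" 0] 3
      by (simp add: representatives_tri m_def)
    ultimately show ?thesis by blast
  qed
  then show "\<exists>Y\<in>?S. similar Y (mix_act (vector [vector [p, q], vector [r, s]]) (pA 0 1))"
    by (simp add: representatives_tri mix_act_tri)
next
  show "?S \<subseteq> orbit32 (pA 0 1)"
    using tri_pair_in_orbit_A[of 1 "l + m" 1 l 0 0 for l m] tri_pair_in_orbit_A[of 1 1 0 l 0 0 for l]
      tri_pair_in_orbit_A[of 0 l 1 1 0 0 for l]
    by (auto simp: representatives_tri)
qed

lemma orbit32_B1_eq: "orbit32 (pB 0 1 :: 'k::field mat3_pair) =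
    GL3_sweep ({pB l m | l m. m \<noteq> 0} \<union> {pB_if m | m. m \<noteq> 0})"
    (is "_ = GL3_sweep ?S")
proof (rule orbit32_eq_GL3_sweepI)
  fix p q r s :: 'k
  assume det: "p * s - q * r \<noteq> 0"
  have "\<exists>Y\<in>?S. similar Y (tri p p q, tri r r s)"
  proof (cases "p = 0")
    case True
    then have nz: "r \<noteq> 0" "q \<noteq> 0" using det by auto
    let ?m = "q / (r * r)"
    have "similar (pB_if ?m) (tri p p q, tri r r s)"
      unfolding representatives_tri
      by (rule similar_tri[where p = 1 and q = 0 and r = 0 and s = 0 and t = r and u = 0
          and v = 0 and w = s and z = "r * r"]) (use nz True in auto)
    moreover have "?m \<noteq> 0" using nz by simp
    ultimately show ?thesis by blast
  next
    case False
    let ?m = "(p * s - q * r) / (p * p * p)"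
    have "r / p * q + ?m * (p * p) = s"
      using False by (simp add: field_simps)
    then have "similar (pB (r / p) ?m) (tri p p q, tri r r s)"
      using similar_B[OF False False, of "r / p" ?m q] False by (simp add: representatives_tri)
    moreover have "?m \<noteq> 0" using det False by simp
    ultimately show ?thesis by blast
  qed
  then show "\<exists>Y\<in>?S. similar Y (mix_act (vector [vector [p, q], vector [r, s]]) (pB 0 1))"
    by (simp add: representatives_tri mix_act_tri)
next
  have "pB l m \<in> orbit32 (pB 0 1)" if "m \<noteq> 0" for l m :: 'k
    using orbit32_mix[OF invertible_mat2[of 1 m 0 l], of "pB 0 1"] that
    by (simp add: representatives_tri mix_act_tri)
  moreover have "pB_if m \<in> orbit32 (pB 0 1)" if "m \<noteq> 0" for m :: 'k
    using orbit32_mix[OF invertible_mat2[of 0 0 m 1], of "pB 0 1"] that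
    by (simp add: representatives_tri mix_act_tri)
  ultimately show "?S \<subseteq> orbit32 (pB 0 1)" by blast
qed

lemma orbit32_B0_eq: "orbit32 (pB 0 0 :: 'k::field mat3_pair) =
    GL3_sweep ({pB l 0 | l. True} \<union> {pB_if 0})"
    (is "_ = GL3_sweep ?S")
proof (rule orbit32_eq_GL3_sweepI)
  fix p q r s :: 'k
  assume det: "p * s - q * r \<noteq> 0"
  have "\<exists>Y\<in>?S. similar Y (tri p p 0, tri r r 0)"
  proof (cases "p = 0")
    case True
    then have nz: "r \<noteq> 0" using det by auto
    have "similar (pB_if 0) (tri p p 0, tri r r 0)"
      using similar_diag[OF nz nz, of 0 0 0 1 1 0] True by (simp add: representatives_tri)
    then show ?thesis by blast
  next
    case False
    then have "similar (pB (r / p) 0) (tri p p 0, tri r r 0)"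
      using similar_B[OF False False, of "r / p" 0 0] by (simp add: representatives_tri)
    then show ?thesis by blast
  qed
  then show "\<exists>Y\<in>?S. similar Y (mix_act (vector [vector [p, q], vector [r, s]]) (pB 0 0))"
    by (simp add: representatives_tri mix_act_tri)
next
  have "pB l 0 \<in> orbit32 (pB 0 0)" for l :: 'k
    using orbit32_mix[OF invertible_mat2[of 1 1 0 l], of "pB 0 0"]
    by (simp add: representatives_tri mix_act_tri)
  moreover have "pB_if 0 \<in> orbit32 (pB 0 0 :: 'k mat3_pair)"
    using orbit32_mix[OF invertible_mat2[of 0 0 1 1], of "pB 0 0"]
    by (simp add: representatives_tri mix_act_tri)
  ultimately show "?S \<subseteq> orbit32 (pB 0 0)" by blast
qed

text \<open>
  A change of basis in the joint image \<open>span {e\<^sub>2, e\<^sub>3}\<close> of the matrices in \<open>C\<close> undoes any mixing;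
  for \<open>D\<close> this happens dually, on the coordinates modulo the common kernel.
\<close>

lemma orbit32_C_eq: "orbit32 (pC :: 'k::field mat3_pair) = GL3_sweep {pC}"
proof (rule orbit32_eq_GL3_sweepI)
  fix p q r s :: 'k
  assume det: "p * s - q * r \<noteq> 0"
  have "similar pC (tri p 0 q, tri r 0 s)"
    unfolding representatives_tri
    by (rule similar_tri[where p = 1 and q = 0 and r = 0 and s = 0 and t = p and u = r
          and v = 0 and w = q and z = s]) (use det in \<open>auto simp: algebra_simps\<close>)
  then show "\<exists>Y\<in>{pC}. similar Y (mix_act (vector [vector [p, q], vector [r, s]]) pC)"
    by (simp add: representatives_tri mix_act_tri)
qed (simp add: orbit32_refl)

lemma orbit32_D_eq: "orbit32 (pD :: 'k::field mat3_pair) = GL3_sweep {pD}"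
proof (rule orbit32_eq_GL3_sweepI)
  fix p q r s :: 'k
  assume det: "p * s - q * r \<noteq> 0"
  have "similar (tri 0 q p, tri 0 s r) pD"
    unfolding representatives_tri
    by (rule similar_tri[where p = p and q = q and r = 0 and s = r and t = s and u = 0
          and v = 0 and w = 0 and z = 1]) (use det in \<open>auto simp: algebra_simps\<close>)
  then show "\<exists>Y\<in>{pD}. similar Y (mix_act (vector [vector [p, q], vector [r, s]]) pD)"
    by (simp add: representatives_tri mix_act_tri similar_sym)
qed (simp add: orbit32_refl)

lemma orbit32_E_eq: "orbit32 (pE 0 :: 'k::field mat3_pair) = GL3_sweep ({pE l | l. True} \<union> {pE_inf})"
    (is "_ = GL3_sweep ?S")
proof (rule orbit32_eq_GL3_sweepI)
  fix p q r s :: 'k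
  assume det: "p * s - q * r \<noteq> 0"
  have "\<exists>Y\<in>?S. similar Y (tri p 0 0, tri r 0 0)"
  proof (cases "p = 0")
    case True
    then have nz: "r \<noteq> 0" using det by auto
    have "similar pE_inf (tri p 0 0, tri r 0 0)"
      using similar_diag[OF nz nz, of 0 0 0 1 0 0] True by (simp add: representatives_tri)
    then show ?thesis by blast
  next
    case False
    then have "similar (pE (r / p)) (tri p 0 0, tri r 0 0)"
      using similar_diag[OF False False, of 1 0 0 "r / p" 0 0] by (simp add: representatives_tri)
    then show ?thesis by blast
  qed
  then show "\<exists>Y\<in>?S. similar Y (mix_act (vector [vector [p, q], vector [r, s]]) (pE 0))"
    by (simp add: representatives_tri mix_act_tri)
next
  have "pE l \<in> orbit32 (pE 0)" for l :: 'k
    using orbit32_mix[OF invertible_mat2[of 1 1 0 l], of "pE 0"]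
    by (simp add: representatives_tri mix_act_tri)
  moreover have "pE_inf \<in> orbit32 (pE 0 :: 'k mat3_pair)"
    using orbit32_mix[OF invertible_mat2[of 0 0 1 1], of "pE 0"]
    by (simp add: representatives_tri mix_act_tri)
  ultimately show "?S \<subseteq> orbit32 (pE 0)" by blast
qed

lemma orbit32_O_eq: "orbit32 (pO :: 'k::field mat3_pair) = {pO}"
proof -
  have "tri 0 0 0 = (0 :: 'k mat3)" by (simp add: mat3_eq_iff forall_3)
  then show ?thesis
    using orbit32_refl[of "pO :: 'k mat3_pair"]
    by (auto simp: orbit32_def conj_act_def mix_act_def pO_def vec_eq_iff matrix_mult_nth)
qed

section \<open>Simultaneous triangularisation of nilpotent pairs\<close>

text \<open>
  A word is a list of the projections \<open>fst\<close> and \<open>snd\<close>, so that the same word can be evaluated at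
  different pairs.  This makes its behaviour under conjugation, and its being a polynomial function of the
  pair, provable by induction.
\<close>

definition word :: "('k::field mat3_pair \<Rightarrow> 'k mat3) list \<Rightarrow> 'k mat3_pair \<Rightarrow> 'k mat3"
  where "word fs X = foldr (**) (map (\<lambda>f. f X) fs) (mat 1)"

definition words_vanish :: "nat \<Rightarrow> 'k::field mat3_pair \<Rightarrow> bool"
  where "words_vanish n X \<longleftrightarrow> (\<forall>fs. length fs = n \<and> set fs \<subseteq> {fst, snd} \<longrightarrow> word fs X = 0)"

lemma word_simps [simp]:
  "word [] X = mat 1"
  "word (f # fs) X = f X ** word fs X"
  by (simp_all add: word_def)

lemma word_append: "word (fs @ gs) X = word fs X ** word gs X"
  by (induction fs) (simp_all add: matrix_mul_assoc)

lemma N32_words_vanish: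
  assumes "X \<in> N32"
  obtains n where "words_vanish n X"
proof -
  from assms obtain n where n: "\<And>As. length As = n \<Longrightarrow> set As \<subseteq> gen_alg {fst X, snd X} \<Longrightarrow>
      foldr (**) As (mat 1) = 0"
    by (auto simp: N32_def nilpotent_alg_def)
  have "words_vanish n X"
    unfolding words_vanish_def word_def
  proof (intro allI impI n)
    fix fs :: "('a mat3_pair \<Rightarrow> 'a mat3) list"
    assume "length fs = n \<and> set fs \<subseteq> {fst, snd}"
    then show "length (map (\<lambda>f. f X) fs) = n" "set (map (\<lambda>f. f X) fs) \<subseteq> gen_alg {fst X, snd X}"
      by (auto intro!: gen_alg.gen)
  qed
  then show thesis by (rule that)
qed

lemma word_intertwine:
  assumes "\<And>f. f \<in> set fs \<Longrightarrow> g ** f X = f Y ** g"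
  shows "g ** word fs X = word fs Y ** g"
  using assms
proof (induction fs)
  case (Cons f fs)
  have "g ** word (f # fs) X = (g ** f X) ** word fs X" by (simp add: matrix_mul_assoc)
  also have "\<dots> = f Y ** (g ** word fs X)" using Cons.prems by (simp add: matrix_mul_assoc)
  also have "\<dots> = word (f # fs) Y ** g" using Cons by (simp add: matrix_mul_assoc)
  finally show ?case .
qed simp

lemma matrix_mult_right_cancel_0:
  fixes A g :: "'k::field^'n^'n"
  assumes "invertible g" "A ** g = 0"
  shows "A = 0"
proof -
  have "A = A ** g ** matrix_inv g"
    by (simp add: matrix_inv_cancel[OF assms(1)] flip: matrix_mul_assoc)
  then show ?thesis using assms(2) by (simp add: vec_eq_iff matrix_mult_nth)
qed

lemma words_vanish_similar:
  assumes "words_vanish n X" "similar X Y"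
  shows "words_vanish n Y"
proof -
  from assms(2) obtain g where g: "invertible g" "g ** fst X = fst Y ** g" "g ** snd X = snd Y ** g"
    by (auto simp: similar_def)
  show ?thesis unfolding words_vanish_def
  proof (intro allI impI)
    fix fs :: "('a mat3_pair \<Rightarrow> 'a mat3) list"
    assume fs: "length fs = n \<and> set fs \<subseteq> {fst, snd}"
    have "word fs Y ** g = g ** word fs X"
      by (rule word_intertwine[symmetric]) (use fs g in auto)
    also have "\<dots> = 0" using fs assms(1) by (simp add: words_vanish_def vec_eq_iff matrix_mult_nth)
    finally show "word fs Y = 0" by (rule matrix_mult_right_cancel_0[OF g(1)])
  qed
qed

text \<open>
  The third column is \<open>v\<close>.  The second is a solution \<open>y\<close> of \<open>y \<times> v = u\<close>, which exists
  because \<open>u\<close> is orthogonal to \<open>v\<close>, and the first is any \<open>x\<close> with \<open>u \<bullet> x = 1\<close>.  The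
  determinant is then \<open>x \<bullet> (y \<times> v) = x \<bullet> u = 1\<close>, and \<open>u\<close> is orthogonal to \<open>y\<close>.
\<close>

lemma adapted_basis:
  fixes u v :: "'k::field^3"
  assumes "u \<noteq> 0" "v \<noteq> 0" "(\<Sum>k\<in>UNIV. u $ k * v $ k) = 0"
  obtains g :: "'k^3^3" where "invertible g" "\<And>k. g $ k $ 3 = v $ k"
    "\<And>j::3. (\<Sum>k\<in>UNIV. u $ k * g $ k $ j) = (if j = 1 then 1 else 0)"
proof -
  obtain x1 x2 x3 where x: "u $ 1 * x1 + u $ 2 * x2 + u $ 3 * x3 = 1"
  proof -
    from assms(1) consider "u $ 1 \<noteq> 0" | "u $ 2 \<noteq> 0" | "u $ 3 \<noteq> 0"
      by (auto simp: vec_eq_iff forall_3)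
    then show ?thesis
      by cases (use that[of "1 / u$1" 0 0] that[of 0 "1 / u$2" 0] that[of 0 0 "1 / u$3"] in auto)
  qed
  have uv: "u$1 * v$1 + u$2 * v$2 + u$3 * v$3 = 0" using assms(3) by (simp add: sum_3)
  obtain y1 y2 y3 where y: "y2 * v$3 - y3 * v$2 = u$1" "y3 * v$1 - y1 * v$3 = u$2"
      "y1 * v$2 - y2 * v$1 = u$3"
  proof -
    from assms(2) consider "v$1 \<noteq> 0" | "v$2 \<noteq> 0" | "v$3 \<noteq> 0"
      by (auto simp: vec_eq_iff forall_3)
    then show ?thesis
    proof cases
      case 1
      have "(- u$3 / v$1) * v$3 - (u$2 / v$1) * v$2 = u$1"
        using 1 uv by (simp add: field_simps) (metis add_eq_0_iff add.commute add.assoc)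
      then show ?thesis using 1 that[of "- u$3 / v$1" "u$2 / v$1" 0] by simp
    next
      case 2
      have "(- u$1 / v$2) * v$1 - (u$3 / v$2) * v$3 = u$2"
        using 2 uv by (simp add: field_simps) (metis add_eq_0_iff add.commute add.assoc)
      then show ?thesis using 2 that[of 0 "- u$1 / v$2" "u$3 / v$2"] by simp
    next
      case 3
      have "(- u$2 / v$3) * v$2 - (u$1 / v$3) * v$1 = u$3"
        using 3 uv by (simp add: field_simps) (metis add_eq_0_iff add.commute add.assoc)
      then show ?thesis using 3 that[of "u$1 / v$3" 0 "- u$2 / v$3"] by simp
    qed
  qed
  let ?g = "mat3 x1 y1 (v$1) x2 y2 (v$2) x3 y3 (v$3)"
  have "det ?g = x1 * (y2 * v$3 - y3 * v$2) + x2 * (y3 * v$1 - y1 * v$3) + x3 * (y1 * v$2 - y2 * v$1)"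
    by (simp add: det_3 algebra_simps)
  also have "\<dots> = 1" using x by (simp add: y mult.commute)
  finally have "invertible ?g" by (simp add: invertible_det_nz)
  moreover have "u$1 * y1 + u$2 * y2 + u$3 * y3 = 0"
    by (simp add: y[symmetric] algebra_simps)
  then have "(\<Sum>k\<in>UNIV. u $ k * ?g $ k $ j) = (if j = 1 then 1 else 0)" for j :: 3
    using exhaust_3[of j] x uv by (auto simp: sum_3)
  moreover have "?g $ k $ 3 = v $ k" for k
    using exhaust_3[of k] by auto
  ultimately show thesis using that by presburger
qed

text \<open>
  Take a nonzero word of maximal length.  Its length is positive because the pair is not zero, so its
  square contains the product of the word with one of the letters and vanishes too.
\<close>

lemma exists_killing_word:
  assumes "words_vanish n X" "X \<noteq> (0, 0)"
  obtains W where "W \<noteq> 0" "W ** W = 0" "\<And>f. f \<in> {fst, snd} \<Longrightarrow> f X ** W = 0"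
    "\<And>f. f \<in> {fst, snd} \<Longrightarrow> W ** f X = 0"
proof -
  define m where "m = (LEAST m. words_vanish m X)"
  have m: "words_vanish m X" unfolding m_def using assms(1) by (rule LeastI)
  have least: "\<not> words_vanish k X" if "k < m" for k
    using that unfolding m_def by (rule not_less_Least)
  have "\<not> words_vanish 0 X" by (simp add: words_vanish_def vec_eq_iff mat_def)
  moreover have "\<not> words_vanish 1 X"
  proof
    assume *: "words_vanish 1 X"
    have "word [fst] X = 0" "word [snd] X = 0"
      by (rule *[unfolded words_vanish_def, rule_format]; simp)+
    then show False using assms(2) by (simp add: prod_eq_iff)
  qed
  ultimately have "m \<noteq> 0" "m \<noteq> 1" using m by metis+
  then obtain k where k: "m = Suc (Suc k)" by (metis One_nat_def not0_implies_Suc)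
  obtain fs where fs: "length fs = Suc k" "set fs \<subseteq> {fst, snd}" "word fs X \<noteq> 0"
    using least[of "Suc k"] by (auto simp: k words_vanish_def)
  have vanish: "word gs X = 0" if "length gs = m" "set gs \<subseteq> {fst, snd}" for gs
    using m that by (simp add: words_vanish_def)
  have left: "f X ** word fs X = 0" if "f \<in> {fst, snd}" for f
    using vanish[of "f # fs"] that fs k by simp
  have right: "word fs X ** f X = 0" if "f \<in> {fst, snd}" for f
    using vanish[of "fs @ [f]"] that fs k by (simp add: word_append)
  obtain f fs' where "fs = f # fs'" using fs(1) by (cases fs) auto
  then have "word fs X ** word fs X = word fs X ** f X ** word fs' X"
    by (simp add: matrix_mul_assoc)
  also have "word fs X ** f X = 0" using right fs(2) \<open>fs = f # fs'\<close> by auto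
  finally have "word fs X ** word fs X = 0" by (simp add: vec_eq_iff matrix_mult_nth)
  with fs(3) left right that show thesis by blast
qed

lemma word_replicate_nth_22:
  assumes "\<And>j. f Y $ 1 $ j = 0" "f Y $ 2 $ 3 = 0"
  shows "word (replicate n f) Y $ 2 $ 2 = (f Y $ 2 $ 2) ^ n"
proof -
  have "word (replicate n f) Y $ 1 $ 2 = 0" for n
    using assms by (cases n) (auto simp: mat_def matrix_mult_nth)
  then show ?thesis
    using assms by (induction n) (auto simp: mat_def matrix_mult_nth sum_3)
qed

text \<open>
  In the basis adapted to a row \<open>u\<close> and a column \<open>v\<close> of the killing word, the first row and the
  third column of both matrices vanish.  The only entry left outside the strictly lower triangular part is
  the middle diagonal one; its powers are entries of powers of the matrix, so nilpotency makes it zero.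
\<close>

lemma words_vanish_similar_tri:
  assumes "words_vanish n X"
  obtains a b c a' b' c' where "similar X (tri a b c, tri a' b' c')"
proof (cases "X = (0, 0)")
  case True
  have "(0, 0) = (tri 0 0 0 :: 'a mat3, tri 0 0 0)"
    by (simp add: mat3_eq_iff forall_3)
  then show ?thesis using True that similar_refl by metis
next
  case False
  obtain W where W: "W \<noteq> 0" "W ** W = 0" and left: "\<And>f. f \<in> {fst, snd} \<Longrightarrow> f X ** W = 0"
    and right: "\<And>f. f \<in> {fst, snd} \<Longrightarrow> W ** f X = 0"
    using exists_killing_word[OF assms False] by metis
  obtain i j where ij: "W $ i $ j \<noteq> 0" using W(1) by (auto simp: vec_eq_iff)
  define u v where "u = W $ i" and "v = (\<chi> k. W $ k $ j)"
  have "u \<noteq> 0" "v \<noteq> 0" using ij by (auto simp: u_def v_def vec_eq_iff)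
  moreover have "(\<Sum>k\<in>UNIV. u $ k * v $ k) = (W ** W) $ i $ j"
    by (simp add: u_def v_def matrix_mult_nth)
  then have "(\<Sum>k\<in>UNIV. u $ k * v $ k) = 0" using W(2) by simp
  ultimately obtain g where g: "invertible g" and g3: "\<And>k. g $ k $ (3::3) = v $ k"
    and ug: "\<And>j::3. (\<Sum>k\<in>UNIV. u $ k * g $ k $ j) = (if j = 1 then 1 else 0)"
    by (rule adapted_basis) blast
  define g' where "g' = matrix_inv g"
  have inv: "g ** g' = mat 1" "g' ** g = mat 1"
    using matrix_inv_cancel[OF g] by (simp_all add: g'_def)
  then have g': "invertible g'" by (auto simp: invertible_def)
  \<comment> \<open>The equation \<open>u g = e\<close> with the first unit row \<open>e\<close> says that \<open>u\<close> is the first row of \<open>g'\<close>.\<close>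
  have ug': "g' $ 1 $ k = u $ k" for k
  proof -
    have "u $ k = (\<Sum>l\<in>UNIV. u $ l * (g ** g') $ l $ k)"
      by (simp add: inv mat_def if_distrib cong: if_cong)
    also have "\<dots> = (\<Sum>m\<in>UNIV. (\<Sum>l\<in>UNIV. u $ l * g $ l $ m) * g' $ m $ k)"
      by (simp add: matrix_mult_nth sum_3 algebra_simps)
    also have "\<dots> = g' $ 1 $ k" by (simp add: ug sum_3)
    finally show ?thesis by simp
  qed
  define Y where "Y = (g' ** fst X ** g, g' ** snd X ** g)"
  have fY: "f Y = g' ** f X ** g" if "f \<in> {fst, snd}" for f
    using that by (auto simp: Y_def)
  have intertwine: "g' ** f X = f Y ** g'" if "f \<in> {fst, snd}" for f
    by (simp add: fY[OF that] inv flip: matrix_mul_assoc)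
  then have "similar X Y" using g' by (auto simp: similar_def)
  have row1: "f Y $ 1 $ l = 0" if "f \<in> {fst, snd}" for f l
  proof -
    have "f Y $ 1 $ l = (W ** f X ** g) $ i $ l"
      by (simp add: fY[OF that] matrix_mult_nth ug' u_def)
    then show ?thesis using right[OF that] by (simp add: matrix_mult_nth)
  qed
  have col3: "f Y $ k $ 3 = 0" if "f \<in> {fst, snd}" for f k
  proof -
    have "f Y $ k $ 3 = (g' ** f X ** W) $ k $ j"
      by (simp add: fY[OF that] matrix_mult_nth g3 v_def)
    also have "g' ** f X ** W = g' ** (f X ** W)" by (simp add: matrix_mul_assoc)
    finally show ?thesis using left[OF that] by (simp add: matrix_mult_nth)
  qed
  have diag: "f Y $ 2 $ 2 = 0" if "f \<in> {fst, snd}" for f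
  proof -
    have "word (replicate n f) Y = 0"
      using words_vanish_similar[OF assms \<open>similar X Y\<close>] that
      by (simp add: words_vanish_def set_replicate_conv_if)
    moreover have "word (replicate n f) Y $ 2 $ 2 = (f Y $ 2 $ 2) ^ n"
      by (rule word_replicate_nth_22) (use row1 col3 that in auto)
    ultimately show ?thesis by simp
  qed
  have "f Y = tri (f Y $ 2 $ 1) (f Y $ 3 $ 2) (f Y $ 3 $ 1)" if "f \<in> {fst, snd}" for f
    using row1[OF that] col3[OF that] diag[OF that] by (simp add: mat3_eq_iff forall_3)
  then have "fst Y = tri (fst Y $ 2 $ 1) (fst Y $ 3 $ 2) (fst Y $ 3 $ 1)"
      "snd Y = tri (snd Y $ 2 $ 1) (snd Y $ 3 $ 2) (snd Y $ 3 $ 1)"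
    by blast+
  then show ?thesis using \<open>similar X Y\<close> that by (metis prod.collapse)
qed

lemma tri_mult_tri_mult_tri: "tri a b c ** (tri a' b' c' ** tri a'' b'' c'') = 0"
  by (simp add: mat3_eq_iff forall_3 matrix_mult_nth sum_3)

lemma tri_in_N32: "(tri a b c, tri a' b' c') \<in> N32"
proof -
  have tri: "\<exists>a b c. A = tri a b c" if "A \<in> gen_alg {tri a b c, tri a' b' c'}" for A
    using that
  proof induction
    case zero
    have "(0 :: 'a mat3) = tri 0 0 0" by (simp add: mat3_eq_iff forall_3)
    then show ?case by blast
  next
    case (mult A B)
    then obtain a b c a' b' c' where "A = tri a b c" "B = tri a' b' c'" by blast
    then have "A ** B = tri 0 0 (b * a')"
      by (simp add: mat3_eq_iff forall_3 matrix_mult_nth sum_3)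
    then show ?case by blast
  qed (use tri_add smult_tri in \<open>blast | metis\<close>)+
  have "foldr (**) As (mat 1) = 0"
    if "length As = 3" "set As \<subseteq> gen_alg {tri a b c, tri a' b' c'}" for As
  proof -
    have "\<exists>A B C. As = [A, B, C]"
      using that(1) by (auto simp: numeral_3_eq_3 length_Suc_conv)
    then obtain A B C where As: "As = [A, B, C]" by blast
    show ?thesis using that(2) tri[of A] tri[of B] tri[of C] tri_mult_tri_mult_tri
      by (fastforce simp: As)
  qed
  then show ?thesis by (auto simp: N32_def nilpotent_alg_def)
qed

lemma words_vanish_3_if_similar_tri:
  assumes "similar (tri a b c, tri a' b' c') X"
  shows "words_vanish 3 X"
proof (rule words_vanish_similar[OF _ assms])
  show "words_vanish 3 (tri a b c, tri a' b' c')"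
    by (auto simp: words_vanish_def numeral_3_eq_3 length_Suc_conv tri_mult_tri_mult_tri)
qed

section \<open>Degenerations along lines\<close>

definition line :: "'k::field mat3_pair \<Rightarrow> 'k mat3_pair \<Rightarrow> 'k \<Rightarrow> 'k mat3_pair"
  where "line U V t = (fst U + t *\<^sub>m fst V, snd U + t *\<^sub>m snd V)"

text \<open>
  Over a finite field the polynomial \<open>1 + \<Prod>a. (x - a)\<close> takes only the value one.
\<close>

lemma infinite_UNIV_alg_closed: "infinite (UNIV :: 'k::alg_closed_field set)"
proof
  assume fin: "finite (UNIV :: 'k set)"
  define p where "p = 1 + (\<Prod>a\<in>UNIV. [:- a, 1 :: 'k:])"
  have deg: "degree (\<Prod>a\<in>UNIV. [:- a, 1 :: 'k:]) = card (UNIV :: 'k set)"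
    by (subst degree_prod_eq_sum_degree) auto
  have "card (UNIV :: 'k set) > 0" using fin by (simp add: card_gt_0_iff)
  then have "degree p > 0" unfolding p_def
    by (subst degree_add_eq_right) (auto simp: deg)
  then obtain x where "poly p x = 0" using alg_closed_imp_poly_has_root by blast
  moreover have "poly p x = 1" using fin by (simp add: p_def poly_prod prod_zero_iff)
  ultimately show False by simp
qed

lemma poly_fun_line:
  assumes "poly_fun f"
  shows "\<exists>q. \<forall>t. f (line U V t) = poly q t"
  using assms
proof induction
  case (const c)
  show ?case by (rule exI[of _ "[:c:]"]) simp
next
  case (coord_fst i j)
  show ?case by (rule exI[of _ "[:fst U $ i $ j, fst V $ i $ j:]"]) (simp add: line_def)
next
  case (coord_snd i j)
  show ?case by (rule exI[of _ "[:snd U $ i $ j, snd V $ i $ j:]"]) (simp add: line_def)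
next
  case (add p q)
  then show ?case by (metis poly_add)
next
  case (mult p q)
  then show ?case by (metis poly_mult)
qed

lemma mix_act_line: "mix_act h (line U V t) = line (mix_act h U) (mix_act h V) t"
  by (simp add: mix_act_def line_def smult_mat_add smult_mat_smult_mat mult.commute add_ac)

lemma conj_act_line: "conj_act g (line U V t) = line (conj_act g U) (conj_act g V) t"
  by (simp add: conj_act_def line_def mat_alg)

lemma conj_mix_in_orbit32: "g \<in> GL \<Longrightarrow> h \<in> GL \<Longrightarrow> conj_act g (mix_act h X) \<in> orbit32 X"
  by (auto simp: orbit32_def)

text \<open>
  Instead of choosing equations for each member, take all polynomial functions that vanish on the
  intersection.
\<close>

lemma zariski_closed_Inter:
  assumes "\<forall>Z\<in>T. zariski_closed Z"
  shows "zariski_closed (\<Inter>T)"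
proof -
  let ?P = "{p. poly_fun p \<and> (\<forall>X\<in>\<Inter>T. p X = 0)}"
  have "X \<in> Z" if "\<forall>p\<in>?P. p X = 0" "Z \<in> T" for X Z
  proof -
    obtain P where P: "\<forall>p\<in>P. poly_fun p" "Z = {X. \<forall>p\<in>P. p X = 0}"
      using assms \<open>Z \<in> T\<close> unfolding zariski_closed_def by blast
    then have "P \<subseteq> ?P" using \<open>Z \<in> T\<close> by auto
    then show ?thesis using that(1) P(2) by blast
  qed
  then have "\<Inter>T = {X. \<forall>p\<in>?P. p X = 0}"
    by (intro equalityI subsetI InterI CollectI ballI) auto
  moreover have "\<forall>p\<in>?P. poly_fun p" by simp
  ultimately show ?thesis unfolding zariski_closed_def by (intro exI[of _ ?P] conjI)
qed

lemma zariski_closed_closure: "zariski_closed (zariski_closure S)"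
  unfolding zariski_closure_def by (rule hull_in) (rule zariski_closed_Inter)

lemma subset_zariski_closure: "S \<subseteq> zariski_closure S"
  by (simp add: zariski_closure_def hull_subset)

lemma zariski_closure_minimal: "S \<subseteq> Z \<Longrightarrow> zariski_closed Z \<Longrightarrow> zariski_closure S \<subseteq> Z"
  unfolding zariski_closure_def by (rule hull_minimal)

lemma degenerates_refl: "degenerates X X"
  by (simp add: degenerates_def zariski_closure_def hull_subset)

lemma degenerates_trans: "degenerates X Y \<Longrightarrow> degenerates Y Z \<Longrightarrow> degenerates X Z"
proof -
  assume XY: "degenerates X Y" and YZ: "degenerates Y Z"
  have "zariski_closure (orbit32 Y) \<subseteq> zariski_closure (orbit32 X)"
    using XY zariski_closed_closure[of "orbit32 X"]
    unfolding degenerates_def zariski_closure_def[of "orbit32 Y"] by (rule hull_minimal)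
  with YZ show ?thesis by (auto simp: degenerates_def)
qed

text \<open>
  The group maps lines to lines and preserves the orbit of \<open>X\<close>, so the argument applies to every
  line obtained by moving the given one; therefore the whole orbit of \<open>U\<close>, and not only \<open>U\<close> itself,
  lies in the closure.
\<close>

lemma degenerates_line:
  fixes U V X :: "'k::field mat3_pair"
  assumes "infinite (UNIV :: 'k set)" and in_orbit: "\<And>t. t \<noteq> 0 \<Longrightarrow> line U V t \<in> orbit32 X"
  shows "degenerates X U"
  unfolding degenerates_def
proof
  fix Y assume "Y \<in> orbit32 U"
  then obtain g h where gh: "g \<in> GL" "h \<in> GL" "Y = conj_act g (mix_act h U)"
    by (auto simp: orbit32_def)
  define W where "W = conj_act g (mix_act h V)"
  have YW: "line Y W t \<in> orbit32 X" if "t \<noteq> 0" for t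
  proof -
    have "conj_act g (mix_act h (line U V t)) \<in> orbit32 (line U V t)"
      by (rule conj_mix_in_orbit32[OF gh(1,2)])
    with in_orbit[OF that] have "conj_act g (mix_act h (line U V t)) \<in> orbit32 X"
      by (rule orbit32_trans)
    then show ?thesis by (simp only: gh(3) W_def mix_act_line conj_act_line)
  qed
  obtain P where P: "\<forall>p\<in>P. poly_fun p" "zariski_closure (orbit32 X) = {X. \<forall>p\<in>P. p X = 0}"
    using zariski_closed_closure[of "orbit32 X"] by (auto simp only: zariski_closed_def)
  have "p Y = 0" if "p \<in> P" for p
  proof -
    obtain q where q: "\<And>t. p (line Y W t) = poly q t"
      using poly_fun_line[OF P(1)[rule_format, OF \<open>p \<in> P\<close>], of Y W] by blast
    have "poly q t = 0" if "t \<noteq> 0" for t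
    proof -
      have "line Y W t \<in> {X. \<forall>p\<in>P. p X = 0}" using subsetD[OF subset_zariski_closure YW[OF that]] by (simp only: P(2))
      then have "p (line Y W t) = 0" using \<open>p \<in> P\<close> by blast
      then show ?thesis by (simp only: q)
    qed
    then have "UNIV - {0} \<subseteq> {t. poly q t = 0}" by auto
    moreover have "infinite (UNIV - {0 :: 'k})" using assms(1) by simp
    ultimately have "infinite {t. poly q t = 0}" using finite_subset by blast
    then have "q = 0" using poly_roots_finite by blast
    moreover have "line Y W 0 = Y" by (simp add: line_def prod_eq_iff vec_eq_iff)
    ultimately show ?thesis using q[of 0] by simp
  qed
  then show "Y \<in> zariski_closure (orbit32 X)" by (simp add: P(2))
qed

lemma line_tri: "line (tri a b c, tri a' b' c') (tri x y z, tri x' y' z') t =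
    (tri (a + t * x) (b + t * y) (c + t * z), tri (a' + t * x') (b' + t * y') (c' + t * z'))"
  by (simp add: line_def smult_tri tri_add)

text \<open>
  The eight edges of the Hasse diagram as explicit lines: the starting point is the representative of the
  smaller orbit (for \<open>D\<close> to \<open>E\<^sub>0\<close>, the pair \<open>(E\<^sub>3\<^sub>1, 0)\<close> of the same orbit).
\<close>

context
  assumes inf: "infinite (UNIV :: 'k::field set)"
begin

lemma degenerates_A_B1: "degenerates (pA 0 1) (pB 0 1 :: 'k mat3_pair)"
  unfolding representatives_tri(4)
  by (rule degenerates_line[OF inf, of _ "(tri 0 0 0, tri 0 1 0)"])
    (use tri_pair_in_orbit_A[of 1 t 1 0 0 1 for t] in \<open>simp add: line_tri\<close>)

lemma degenerates_B1_B0: "degenerates (pB 0 1) (pB 0 0 :: 'k mat3_pair)"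
  unfolding representatives_tri(4)[of 0 0]
  by (rule degenerates_line[OF inf, of _ "(tri 0 0 0, tri 0 0 1)"])
    (use tri_pair_in_orbit_B1[of 1 1 t 0 for t] in \<open>simp add: line_tri\<close>)

lemma degenerates_B1_C: "degenerates (pB 0 1) (pC :: 'k mat3_pair)"
  unfolding representatives_tri(6)
  by (rule degenerates_line[OF inf, of _ "(tri 0 1 0, tri 0 0 0)"])
    (use tri_pair_in_orbit_B1[of 1 t 1 0 for t] in \<open>simp add: line_tri\<close>)

lemma degenerates_B1_D: "degenerates (pB 0 1) (pD :: 'k mat3_pair)"
  unfolding representatives_tri(7)
proof (rule degenerates_line[OF inf, of _ "(tri 0 0 0, tri 1 0 0)"])
  fix t :: 'k assume "t \<noteq> 0"
  let ?h = "vector [vector [0, 1], vector [1, 0]] :: 'k^2^2"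
  have "(tri t 1 0, tri 0 0 1) \<in> orbit32 (pB 0 1)"
    using tri_pair_in_orbit_B1[of t 1 1 0] \<open>t \<noteq> 0\<close> by simp
  moreover have "mix_act ?h (tri t 1 0, tri 0 0 1) \<in> orbit32 (tri t 1 0, tri 0 0 1)"
    by (rule orbit32_mix, rule invertible_mat2) simp
  ultimately show "line (tri 0 0 1, tri 0 1 0) (tri 0 0 0, tri 1 0 0) t \<in> orbit32 (pB 0 1)"
    using orbit32_trans by (simp add: mix_act_tri line_tri) blast
qed

lemma degenerates_B0_E: "degenerates (pB 0 0) (pE 0 :: 'k mat3_pair)"
  unfolding representatives_tri(8)
  by (rule degenerates_line[OF inf, of _ "(tri 0 1 0, tri 0 0 0)"])
    (use tri_pair_in_orbit_B0[of 1 t 0 for t] in \<open>simp add: line_tri\<close>)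

lemma degenerates_C_E: "degenerates pC (pE 0 :: 'k mat3_pair)"
  unfolding representatives_tri(8)
  by (rule degenerates_line[OF inf, of _ "(tri 0 0 0, tri 0 0 1)"])
    (use tri_pair_in_orbit_C[of 1 t 0 0 for t] in \<open>simp add: line_tri\<close>)

lemma degenerates_D_E: "degenerates pD (pE 0 :: 'k mat3_pair)"
proof -
  have "degenerates pD (tri 0 0 1, tri 0 0 0 :: 'k mat3)"
    by (rule degenerates_line[OF inf, of _ "(tri 0 0 0, tri 0 1 0)"])
      (use tri_pair_in_orbit_D[of 1 t 0 0 for t] in \<open>simp add: line_tri\<close>)
  moreover have "orbit32 (tri 0 0 1, tri 0 0 0 :: 'k mat3) = orbit32 (pE 0)"
    by (rule orbit32_eqI, rule tri_pair_in_orbit_E) auto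
  ultimately show ?thesis by (simp add: degenerates_def)
qed

lemma degenerates_E_O: "degenerates (pE 0) (pO :: 'k mat3_pair)"
  unfolding representatives_tri(10)
  by (rule degenerates_line[OF inf, of _ "(tri 1 0 0, tri 0 0 0)"])
    (use tri_pair_in_orbit_E[of t 0 0 for t] in \<open>simp add: line_tri\<close>)

end

section \<open>Closed conditions that obstruct degenerations\<close>

lemma zariski_closed_all_imp:
  assumes "\<And>i. Q i \<Longrightarrow> zariski_closed {X. P i X}"
  shows "zariski_closed {X. \<forall>i. Q i \<longrightarrow> P i X}"
proof -
  have "{X. \<forall>i. Q i \<longrightarrow> P i X} = \<Inter>((\<lambda>i. {X. P i X}) ` {i. Q i})" by auto
  then show ?thesis using assms by (auto intro: zariski_closed_Inter)
qed

lemma zariski_closed_all: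
  "(\<And>i. zariski_closed {X. P i X}) \<Longrightarrow> zariski_closed {X. \<forall>i. P i X}"
  using zariski_closed_all_imp[of "\<lambda>_. True" P] by simp

lemma zariski_closed_eq:
  assumes "poly_fun p" "poly_fun q"
  shows "zariski_closed {X. p X = q X}"
proof -
  let ?f = "\<lambda>X. p X + (-1) * q X"
  have "poly_fun ?f" using assms by (intro poly_fun.intros)
  then show ?thesis
    unfolding zariski_closed_def by (intro exI[of _ "{?f}"]) auto
qed

text \<open>
  Together with the orbit of \<open>X\<close> its closure lies in \<open>Z\<close>, so one polynomial equation that holds on
  the orbit of \<open>X\<close> and fails at \<open>Y\<close> rules out a degeneration.
\<close>

lemma not_degeneratesI:
  assumes "zariski_closed Z" "\<And>Y. Y \<in> orbit32 X \<Longrightarrow> Y \<in> Z" "Y \<notin> Z"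
  shows "\<not> degenerates X Y"
proof
  assume "degenerates X Y"
  then have "Y \<in> zariski_closure (orbit32 X)"
    using orbit32_refl[of Y] unfolding degenerates_def by blast
  moreover have "zariski_closure (orbit32 X) \<subseteq> Z"
    using assms(1,2) by (intro zariski_closure_minimal) auto
  ultimately show False using assms(3) by blast
qed

lemma poly_fun_sum:
  "(\<And>i. i \<in> I \<Longrightarrow> poly_fun (f i)) \<Longrightarrow> poly_fun (\<lambda>X. \<Sum>i\<in>I. f i X)"
  by (induction I rule: infinite_finite_induct) (auto intro: poly_fun.intros)

lemma poly_fun_matrix_mult:
  assumes "\<And>i j. poly_fun (\<lambda>X. F X $ i $ j)" "\<And>i j. poly_fun (\<lambda>X. G X $ i $ j)"
  shows "poly_fun (\<lambda>X. (F X ** G X) $ i $ j)"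
  unfolding matrix_mult_nth by (intro poly_fun_sum poly_fun.mult assms)

lemma poly_fun_coord: "f \<in> {fst, snd} \<Longrightarrow> poly_fun (\<lambda>X. f X $ i $ j)"
  using poly_fun.coord_fst poly_fun.coord_snd by auto

lemma poly_fun_word: "set fs \<subseteq> {fst, snd} \<Longrightarrow> poly_fun (\<lambda>X. word fs X $ i $ j)"
proof (induction fs arbitrary: i j)
  case Nil
  then show ?case by (simp add: poly_fun.const)
next
  case (Cons f fs)
  then have "\<And>i j. poly_fun (\<lambda>X. f X $ i $ j)" by (intro poly_fun_coord) simp
  moreover have "\<And>i j. poly_fun (\<lambda>X. word fs X $ i $ j)" using Cons by simp
  ultimately show ?case by (simp add: poly_fun_matrix_mult)
qed

lemma zariski_closed_words_vanish: "zariski_closed {X. words_vanish n X}"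
  unfolding words_vanish_def mat3_eq_iff
  by (intro zariski_closed_all_imp zariski_closed_all zariski_closed_eq poly_fun_word)
    (auto intro: poly_fun.const)

lemma zariski_closed_commuting: "zariski_closed {X. fst X ** snd X = snd X ** fst X}"
  unfolding mat3_eq_iff
  by (intro zariski_closed_all zariski_closed_eq poly_fun_matrix_mult poly_fun_coord) auto

lemma commuting_orbit32:
  assumes comm: "fst X ** snd X = snd X ** fst X" and "Y \<in> orbit32 X"
  shows "fst Y ** snd Y = snd Y ** fst Y"
proof -
  obtain h where h: "similar (mix_act h X) Y"
    using assms(2) by (auto simp: in_orbit32_iff)
  let ?M = "mix_act h X"
  obtain g where g: "invertible g" "g ** fst ?M = fst Y ** g" "g ** snd ?M = snd Y ** g"
    using h by (auto simp: similar_def)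
  have "fst ?M ** snd ?M = snd ?M ** fst ?M"
    by (simp add: mix_act_def mat_alg comm add_ac mult_ac)
  moreover have "g ** word [fst, snd] ?M = word [fst, snd] Y ** g"
    "g ** word [snd, fst] ?M = word [snd, fst] Y ** g"
    by (rule word_intertwine; use g in auto)+
  ultimately have "fst Y ** snd Y ** g = snd Y ** fst Y ** g" by simp
  then have "fst Y ** snd Y ** (g ** matrix_inv g) = snd Y ** fst Y ** (g ** matrix_inv g)"
    by (simp add: matrix_mul_assoc)
  then show ?thesis by (simp add: matrix_inv_cancel[OF g(1)])
qed

lemma not_degenerates_B1_A: "\<not> degenerates (pB 0 1) (pA 0 1 :: 'k::field mat3_pair)"
proof (rule not_degeneratesI[OF zariski_closed_commuting], unfold mem_Collect_eq)
  show "fst Y ** snd Y = snd Y ** fst Y" if "Y \<in> orbit32 (pB 0 1)" for Y :: "'k mat3_pair"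
    by (rule commuting_orbit32[OF _ that]) (simp add: representatives_tri tri_mult_3)
  show "fst (pA 0 1 :: 'k mat3_pair) ** snd (pA 0 1) \<noteq> snd (pA 0 1) ** fst (pA 0 1)"
    by (simp add: representatives_tri tri_mult_3) (simp add: mat3_eq_iff forall_3 E_def)
qed

lemma orbit32_proportional:
  assumes "Y \<in> orbit32 (M, 0)"
  shows "\<exists>N p q. Y = (p *\<^sub>m N, q *\<^sub>m N)"
proof -
  obtain g h where "Y = conj_act g (mix_act h (M, 0))"
    using assms by (auto simp: orbit32_def)
  then have "Y = (h$1$1 *\<^sub>m (g ** M ** matrix_inv g), h$2$1 *\<^sub>m (g ** M ** matrix_inv g))"
    by (simp add: conj_act_def mix_act_def mat_alg vec_eq_iff matrix_mult_nth)
  then show ?thesis by blast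
qed

lemma not_degenerates_proportional:
  assumes "fst Y $ i $ j * snd Y $ k $ l \<noteq> fst Y $ k $ l * snd Y $ i $ j"
  shows "\<not> degenerates (M, 0) Y"
proof (rule not_degeneratesI)
  let ?Z = "{X. \<forall>i j k l. fst X $ i $ j * snd X $ k $ l = fst X $ k $ l * snd X $ i $ j}"
  show "zariski_closed ?Z"
    by (intro zariski_closed_all zariski_closed_eq poly_fun.intros)
  show "X \<in> ?Z" if "X \<in> orbit32 (M, 0)" for X
    using orbit32_proportional[OF that] by auto
  show "Y \<notin> ?Z" using assms by blast
qed

lemma not_degenerates_B0_C: "\<not> degenerates (pB 0 0) (pC :: 'k::field mat3_pair)"
proof -
  have "pB 0 0 = (tri 1 1 0, 0 :: 'k mat3)" by (simp add: representatives_tri mat3_eq_iff forall_3)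
  then show ?thesis
    using not_degenerates_proportional[of "pC :: 'k mat3_pair" 2 1 3 1] by (simp add: representatives_tri)
qed

lemma not_degenerates_B0_D: "\<not> degenerates (pB 0 0) (pD :: 'k::field mat3_pair)"
proof -
  have "pB 0 0 = (tri 1 1 0, 0 :: 'k mat3)" by (simp add: representatives_tri mat3_eq_iff forall_3)
  then show ?thesis
    using not_degenerates_proportional[of "pD :: 'k mat3_pair" 3 1 3 2] by (simp add: representatives_tri)
qed

definition outer :: "'k::field^3 \<Rightarrow> 'k^3 \<Rightarrow> 'k mat3"
  where "outer x w = (\<chi> i j. x $ i * w $ j)"

lemma outer_nth [simp]: "outer x w $ i $ j = x $ i * w $ j"
  by (simp add: outer_def)

lemma matrix_mult_outer: "A ** outer x w = outer (A *v x) w"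
  by (simp add: mat3_eq_iff matrix_mult_nth matrix_vector_mult_def sum_distrib_right mult.assoc)

lemma outer_matrix_mult: "outer x w ** A = outer x (w v* A)"
  by (simp add: mat3_eq_iff matrix_mult_nth vector_matrix_mult_def sum_distrib_left mult_ac)

text \<open>
  Pairs in the orbit of \<open>C\<close> have a common row space of dimension at most one, and those in the orbit
  of \<open>D\<close> a common column space.  Closed conditions result from the two-by-two minors of the matrices stacked
  vertically, respectively side by side.
\<close>

lemma orbit32_C_outer:
  assumes "Y \<in> orbit32 pC"
  shows "\<exists>x y w. Y = (outer x w, outer y w)"
proof -
  obtain g h where Y: "Y = conj_act g (mix_act h pC)"
    using assms by (auto simp: orbit32_def)
  have "mix_act h pC = (outer (vector [0, h$1$1, h$1$2]) (vector [1, 0, 0]),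
      outer (vector [0, h$2$1, h$2$2]) (vector [1, 0, 0]))"
    by (simp add: mix_act_def representatives_tri mat3_eq_iff forall_3)
  then have "Y = (outer (g *v vector [0, h$1$1, h$1$2]) (vector [1, 0, 0] v* matrix_inv g),
      outer (g *v vector [0, h$2$1, h$2$2]) (vector [1, 0, 0] v* matrix_inv g))"
    by (simp add: Y conj_act_def matrix_mult_outer outer_matrix_mult)
  then show ?thesis by blast
qed

lemma orbit32_D_outer:
  assumes "Y \<in> orbit32 pD"
  shows "\<exists>x v w. Y = (outer x v, outer x w)"
proof -
  obtain g h where Y: "Y = conj_act g (mix_act h pD)"
    using assms by (auto simp: orbit32_def)
  have "mix_act h pD = (outer (vector [0, 0, 1]) (vector [h$1$1, h$1$2, 0]),
      outer (vector [0, 0, 1]) (vector [h$2$1, h$2$2, 0]))"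
    by (simp add: mix_act_def representatives_tri mat3_eq_iff forall_3)
  then have "Y = (outer (g *v vector [0, 0, 1]) (vector [h$1$1, h$1$2, 0] v* matrix_inv g),
      outer (g *v vector [0, 0, 1]) (vector [h$2$1, h$2$2, 0] v* matrix_inv g))"
    by (simp add: Y conj_act_def matrix_mult_outer outer_matrix_mult)
  then show ?thesis by blast
qed

lemma not_degenerates_C:
  assumes "e \<in> {fst, snd}" "f \<in> {fst, snd}" "e Y $ i $ j * f Y $ k $ l \<noteq> e Y $ i $ l * f Y $ k $ j"
  shows "\<not> degenerates pC Y"
proof (rule not_degeneratesI)
  let ?Z = "{X. \<forall>e. e \<in> {fst, snd} \<longrightarrow> (\<forall>f. f \<in> {fst, snd} \<longrightarrow>
    (\<forall>i j k l. e X $ i $ j * f X $ k $ l = e X $ i $ l * f X $ k $ j))}"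
  show "zariski_closed ?Z"
    by (intro zariski_closed_all zariski_closed_all_imp zariski_closed_eq poly_fun.mult poly_fun_coord)
  show "X \<in> ?Z" if "X \<in> orbit32 pC" for X
    using orbit32_C_outer[OF that] by auto
  show "Y \<notin> ?Z"
  proof
    assume "Y \<in> ?Z"
    from assms(3) this[unfolded mem_Collect_eq, rule_format, OF assms(1,2)] show False
      by (rule notE)
  qed
qed

lemma not_degenerates_D:
  assumes "e \<in> {fst, snd}" "f \<in> {fst, snd}" "e Y $ i $ j * f Y $ k $ l \<noteq> e Y $ k $ j * f Y $ i $ l"
  shows "\<not> degenerates pD Y"
proof (rule not_degeneratesI)
  let ?Z = "{X. \<forall>e. e \<in> {fst, snd} \<longrightarrow> (\<forall>f. f \<in> {fst, snd} \<longrightarrow>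
    (\<forall>i j k l. e X $ i $ j * f X $ k $ l = e X $ k $ j * f X $ i $ l))}"
  show "zariski_closed ?Z"
    by (intro zariski_closed_all zariski_closed_all_imp zariski_closed_eq poly_fun.mult poly_fun_coord)
  show "X \<in> ?Z" if "X \<in> orbit32 pD" for X
    using orbit32_D_outer[OF that] by auto
  show "Y \<notin> ?Z"
  proof
    assume "Y \<in> ?Z"
    from assms(3) this[unfolded mem_Collect_eq, rule_format, OF assms(1,2)] show False
      by (rule notE)
  qed
qed

lemma not_degenerates_C_B0: "\<not> degenerates pC (pB 0 0 :: 'k::field mat3_pair)"
  using not_degenerates_C[of fst fst "pB 0 0 :: 'k mat3_pair" 2 1 3 2] by (simp add: representatives_tri)

lemma not_degenerates_C_D: "\<not> degenerates pC (pD :: 'k::field mat3_pair)"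
  using not_degenerates_C[of fst snd "pD :: 'k mat3_pair" 3 1 3 2] by (simp add: representatives_tri)

lemma not_degenerates_D_B0: "\<not> degenerates pD (pB 0 0 :: 'k::field mat3_pair)"
  using not_degenerates_D[of fst fst "pB 0 0 :: 'k mat3_pair" 2 1 3 2] by (simp add: representatives_tri)

lemma not_degenerates_D_C: "\<not> degenerates pD (pC :: 'k::field mat3_pair)"
  using not_degenerates_D[of fst snd "pC :: 'k mat3_pair" 2 1 3 1] by (simp add: representatives_tri)

lemma not_degenerates_O_E: "\<not> degenerates pO (pE 0 :: 'k::field mat3_pair)"
proof (rule not_degeneratesI)
  let ?Z = "{X :: 'k mat3_pair. fst X $ 2 $ 1 = 0}"
  show "zariski_closed ?Z"
    by (intro zariski_closed_eq poly_fun.intros)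
  show "X \<in> ?Z" if "X \<in> orbit32 pO" for X
    using that[unfolded orbit32_O_eq] by (simp add: pO_def)
  show "pE 0 \<notin> ?Z" by (simp add: representatives_tri)
qed

section \<open>The degeneration order\<close>

datatype orbit_type = TypeA | TypeB1 | TypeB0 | TypeC | TypeD | TypeE | TypeO

fun rep :: "orbit_type \<Rightarrow> 'k::field mat3_pair" where
  "rep TypeA = pA 0 1"
| "rep TypeB1 = pB 0 1"
| "rep TypeB0 = pB 0 0"
| "rep TypeC = pC"
| "rep TypeD = pD"
| "rep TypeE = pE 0"
| "rep TypeO = pO"

text \<open>
  The rank function of the degeneration poset.
\<close>

fun level :: "orbit_type \<Rightarrow> nat" where
  "level TypeA = 4"
| "level TypeB1 = 3"
| "level TypeB0 = 2"
| "level TypeC = 2"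
| "level TypeD = 2"
| "level TypeE = 1"
| "level TypeO = 0"

lemma UNIV_orbit_type: "UNIV = {TypeA, TypeB1, TypeB0, TypeC, TypeD, TypeE, TypeO}"
  using orbit_type.exhaust by auto

lemma degenerates_rep_Suc:
  assumes "infinite (UNIV :: 'k::field set)" "level i = Suc (level j)"
  shows "degenerates (rep i) (rep j :: 'k mat3_pair)"
  using assms(2) degenerates_A_B1[OF assms(1)] degenerates_B1_B0[OF assms(1)]
    degenerates_B1_C[OF assms(1)] degenerates_B1_D[OF assms(1)] degenerates_B0_E[OF assms(1)]
    degenerates_C_E[OF assms(1)] degenerates_D_E[OF assms(1)] degenerates_E_O[OF assms(1)]
  by (cases i; cases j) simp_all

lemma exists_level: "n \<le> 4 \<Longrightarrow> \<exists>i. level i = n"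
proof -
  assume "n \<le> 4"
  then have "n \<in> level ` {TypeA, TypeB1, TypeC, TypeE, TypeO}" by auto
  then show ?thesis by blast
qed

lemma level_le: "level i \<le> 4" by (cases i) auto

text \<open>
  Every level is occupied, and consecutive levels are completely joined; so one can climb down level by
  level, through any orbit of the level in between.
\<close>

lemma degenerates_rep_if_level_less:
  assumes inf: "infinite (UNIV :: 'k::field set)" and "level j < level i"
  shows "degenerates (rep i) (rep j :: 'k mat3_pair)"
  using assms(2)
proof (induction "level i - level j" arbitrary: j rule: less_induct)
  case less
  show ?case
  proof (cases "level i = Suc (level j)")
    case True
    then show ?thesis by (rule degenerates_rep_Suc[OF inf])
  next
    case False
    obtain k where k: "level k = Suc (level j)"
      using exists_level[of "Suc (level j)"] less.prems level_le[of i] by auto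
    have "degenerates (rep i) (rep k :: 'k mat3_pair)"
      using less.prems False k by (intro less.hyps) auto
    then show ?thesis using degenerates_rep_Suc[OF inf k] degenerates_trans by blast
  qed
qed

lemma not_degenerates_rep_same_level:
  assumes "level i = level j" "i \<noteq> j"
  shows "\<not> degenerates (rep i) (rep j :: 'k::field mat3_pair)"
  using assms not_degenerates_B0_C not_degenerates_B0_D not_degenerates_C_B0 not_degenerates_C_D
    not_degenerates_D_B0 not_degenerates_D_C
  by (cases i; cases j) simp_all

text \<open>
  If one of the two levels contains another orbit \<open>k\<close>, a degeneration from the lower to the
  upper level would, composed with an edge, relate two different orbits of the same level.  This argument
  covers all cases except \<open>B\<^sub>0\<^sub>,\<^sub>1\<close> to \<open>A\<^sub>0\<^sub>,\<^sub>1\<close> and \<open>O\<close> to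
  \<open>E\<^sub>0\<close>, where both levels are singletons.
\<close>

lemma not_degenerates_rep_Suc:
  assumes inf: "infinite (UNIV :: 'k::field set)" and "level j = Suc (level i)"
  shows "\<not> degenerates (rep i) (rep j :: 'k mat3_pair)"
proof -
  have *: "\<not> degenerates (rep i) (rep j :: 'k mat3_pair)"
    if "level k = level i" "k \<noteq> i" "level j = Suc (level i)" for i j k
    using that not_degenerates_rep_same_level[of i k] degenerates_rep_Suc[OF inf, of j k]
      degenerates_trans by metis
  have **: "\<not> degenerates (rep i) (rep j :: 'k mat3_pair)"
    if "level k = level j" "k \<noteq> j" "level j = Suc (level i)" for i j k
    using that not_degenerates_rep_same_level[of k j] degenerates_rep_Suc[OF inf, of k i]
      degenerates_trans by metis
  show ?thesis
    using assms(2) *[of TypeC TypeB0 TypeB1] *[of TypeD TypeC TypeB1] *[of TypeC TypeD TypeB1]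
     **[of TypeC TypeB0 TypeE] **[of TypeD TypeC TypeE] **[of TypeC TypeD TypeE]
     not_degenerates_B1_A not_degenerates_O_E
    by (cases i; cases j) simp_all
qed

lemma degenerates_rep_iff:
  assumes inf: "infinite (UNIV :: 'k::field set)"
  shows "degenerates (rep i) (rep j :: 'k mat3_pair) \<longleftrightarrow> i = j \<or> level j < level i"
proof (intro iffI)
  assume *: "degenerates (rep i) (rep j :: 'k mat3_pair)"
  show "i = j \<or> level j < level i"
  proof (rule ccontr)
    assume "\<not> (i = j \<or> level j < level i)"
    then consider "i \<noteq> j" "level i = level j" | "level i < level j" by linarith
    then show False
    proof cases
      case 1
      then show False using * not_degenerates_rep_same_level by blast
    next
      case 2
      then obtain k where k: "level k = Suc (level i)"
        using exists_level[of "Suc (level i)"] level_le[of j] by auto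
      \<comment> \<open>Descending from \<open>j\<close> to the level just above \<open>i\<close> yields a degeneration that climbs a single level.\<close>
      have "degenerates (rep j) (rep k :: 'k mat3_pair)" if "j \<noteq> k" "level j \<noteq> level k"
        using degenerates_rep_if_level_less[OF inf, of k j] 2 k that by simp
      then show False
        using * k not_degenerates_rep_Suc[OF inf, of k i] not_degenerates_rep_Suc[OF inf, of j i]
          degenerates_trans by metis
    qed
  qed
next
  assume "i = j \<or> level j < level i"
  then show "degenerates (rep i) (rep j :: 'k mat3_pair)"
    using degenerates_refl degenerates_rep_if_level_less[OF inf] by blast
qed

lemma orbit32_rep_eq_iff:
  assumes inf: "infinite (UNIV :: 'k::field set)"
  shows "orbit32 (rep i) = orbit32 (rep j :: 'k mat3_pair) \<longleftrightarrow> i = j"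
proof
  assume "orbit32 (rep i) = orbit32 (rep j :: 'k mat3_pair)"
  then have "degenerates (rep i) (rep j :: 'k mat3_pair)" "degenerates (rep j) (rep i :: 'k mat3_pair)"
    using subset_zariski_closure by (auto simp: degenerates_def)
  then show "i = j" by (auto simp: degenerates_rep_iff[OF inf])
qed simp

lemma orbit32_eq_rep_if_words_vanish:
  assumes "words_vanish n X"
  shows "\<exists>i. orbit32 X = orbit32 (rep i)"
proof -
  obtain a b c a' b' c' where s: "similar X (tri a b c, tri a' b' c')"
    using words_vanish_similar_tri[OF assms] by blast
  have "{pA 0 1, pB 0 1, pB 0 0, pC, pD, pE 0, pO} = range (rep :: orbit_type \<Rightarrow> 'a mat3_pair)"
    by (simp add: UNIV_orbit_type)
  then obtain i where "(tri a b c, tri a' b' c') \<in> orbit32 (rep i)"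
    using tri_pair_cases[of a b c a' b' c'] by auto
  moreover have "X \<in> orbit32 (tri a b c, tri a' b' c')"
    using s similar_sym orbit32_similar by blast
  ultimately show ?thesis using orbit32_trans orbit32_eqI by metis
qed

lemma rep_eq_tri: "\<exists>a b c a' b' c'. rep i = (tri a b c, tri a' b' c')"
  by (cases i) (auto simp: representatives_tri)

lemma rep_in_N32: "rep i \<in> N32"
  using rep_eq_tri[of i] tri_in_N32 by metis

lemma orbits_N32: "{orbit32 X | X. X \<in> N32} = range (\<lambda>i. orbit32 (rep i))"
proof (intro equalityI subsetI)
  fix S assume "S \<in> {orbit32 X | X. X \<in> N32}"
  then obtain X where X: "S = orbit32 X" "X \<in> N32" by blast
  obtain n where "words_vanish n X" using N32_words_vanish[OF X(2)] .
  then show "S \<in> range (\<lambda>i. orbit32 (rep i))"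
    using orbit32_eq_rep_if_words_vanish X(1) by blast
qed (use rep_in_N32 in blast)

text \<open>
  All words of length three vanish on the orbit of a triangular pair, hence on its closure; and any pair
  on which the words of some length vanish is triangularisable.
\<close>

lemma degenerates_from_rep:
  assumes "degenerates (rep i) Z"
  shows "\<exists>k. orbit32 Z = orbit32 (rep k)"
proof -
  have "words_vanish 3 X" if "X \<in> orbit32 (rep i)" for X :: "'a mat3_pair"
  proof -
    obtain h where h: "similar (mix_act h (rep i)) X"
      using \<open>X \<in> orbit32 (rep i)\<close> by (auto simp: in_orbit32_iff)
    obtain a b c a' b' c' where "mix_act h (rep i) = (tri a b c, tri a' b' c')"
      using rep_eq_tri[of i] mix_act_tri_ex by metis
    with h show ?thesis using words_vanish_3_if_similar_tri by metis
  qed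
  then have "zariski_closure (orbit32 (rep i)) \<subseteq> {X :: 'a mat3_pair. words_vanish 3 X}"
    by (intro zariski_closure_minimal zariski_closed_words_vanish) blast
  then have "words_vanish 3 Z"
    using assms orbit32_refl[of Z] unfolding degenerates_def by blast
  then show ?thesis by (rule orbit32_eq_rep_if_words_vanish)
qed

text \<open>
  By the previous lemma an orbit strictly between two of the representatives is itself represented, so
  minimality can be decided by comparing levels.
\<close>

lemma minimal_degeneration_rep_iff:
  assumes inf: "infinite (UNIV :: 'k::field set)"
  shows "minimal_degeneration (rep i) (rep j :: 'k mat3_pair) \<longleftrightarrow> level i = Suc (level j)"
proof -
  have "(\<exists>Z :: 'k mat3_pair. orbit32 Z \<noteq> orbit32 (rep i) \<and> orbit32 Z \<noteq> orbit32 (rep j) \<and>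
      degenerates (rep i) Z \<and> degenerates Z (rep j)) \<longleftrightarrow>
    (\<exists>k. k \<noteq> i \<and> k \<noteq> j \<and> degenerates (rep i) (rep k :: 'k mat3_pair) \<and>
      degenerates (rep k) (rep j :: 'k mat3_pair))" (is "?L \<longleftrightarrow> ?R")
  proof
    assume ?L
    then obtain Z :: "'k mat3_pair" where Z: "orbit32 Z \<noteq> orbit32 (rep i)" "orbit32 Z \<noteq> orbit32 (rep j)"
      "degenerates (rep i) Z" "degenerates Z (rep j)" by blast
    obtain k where k: "orbit32 Z = orbit32 (rep k)" using degenerates_from_rep[OF Z(3)] by blast
    from Z have "k \<noteq> i" "k \<noteq> j" using k by auto
    moreover have "degenerates (rep i) (rep k :: 'k mat3_pair)" "degenerates (rep k) (rep j :: 'k mat3_pair)"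
      using Z(3,4) k by (simp_all add: degenerates_def)
    ultimately show ?R by blast
  next
    assume ?R
    then obtain k where "k \<noteq> i" "k \<noteq> j" "degenerates (rep i) (rep k :: 'k mat3_pair)"
      "degenerates (rep k) (rep j :: 'k mat3_pair)" by blast
    then show ?L
      by (intro exI[of _ "rep k"] conjI) (simp_all add: orbit32_rep_eq_iff[OF inf])
  qed
  then have "minimal_degeneration (rep i) (rep j :: 'k mat3_pair) \<longleftrightarrow>
    level j < level i \<and> \<not> (\<exists>k. level k < level i \<and> level j < level k)"
    unfolding minimal_degeneration_def
    by (auto simp: degenerates_rep_iff[OF inf] orbit32_rep_eq_iff[OF inf])
  also have "\<dots> \<longleftrightarrow> level i = Suc (level j)"
  proof
    assume *: "level j < level i \<and> \<not> (\<exists>k. level k < level i \<and> level j < level k)"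
    show "level i = Suc (level j)"
    proof (rule ccontr)
      assume "level i \<noteq> Suc (level j)"
      moreover obtain k where "level k = Suc (level j)"
        using exists_level[of "Suc (level j)"] * level_le[of i] by auto
      ultimately show False using * by (metis Suc_lessI lessI)
    qed
  qed auto
  finally show ?thesis .
qed

lemma minimal_degenerations_N32:
  assumes inf: "infinite (UNIV :: 'k::field set)"
  shows "{(orbit32 X, orbit32 Y) | X Y. X \<in> (N32 :: 'k mat3_pair set) \<and> Y \<in> N32 \<and>
          minimal_degeneration X Y} =
      {(orbit32 (rep i), orbit32 (rep j)) | i j. level i = Suc (level j)}"
    (is "?L = ?R")
proof (intro equalityI subsetI)
  fix e assume "e \<in> ?L"
  then obtain X Y :: "'k mat3_pair" where XY: "e = (orbit32 X, orbit32 Y)" "X \<in> N32" "Y \<in> N32"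
    "minimal_degeneration X Y" by blast
  have "orbit32 Z \<in> range (\<lambda>i. orbit32 (rep i))" if "Z \<in> N32" for Z :: "'k mat3_pair"
    unfolding orbits_N32[symmetric] using that by blast
  from this[OF XY(2)] this[OF XY(3)]
  obtain i j where ij: "orbit32 X = orbit32 (rep i)" "orbit32 Y = orbit32 (rep j)"
    by (elim rangeE)
  then have "minimal_degeneration (rep i) (rep j :: 'k mat3_pair)"
    using XY(4) by (simp add: minimal_degeneration_def degenerates_def)
  then have "level i = Suc (level j)" by (simp add: minimal_degeneration_rep_iff[OF inf])
  then show "e \<in> ?R" unfolding XY(1) ij by blast
next
  fix e assume "e \<in> ?R"
  then obtain i j where ij: "e = (orbit32 (rep i), orbit32 (rep j :: 'k mat3_pair))"
    "level i = Suc (level j)" by blast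
  then have "minimal_degeneration (rep i) (rep j :: 'k mat3_pair)"
    by (simp add: minimal_degeneration_rep_iff[OF inf])
  then show "e \<in> ?L"
    unfolding ij(1) mem_Collect_eq
    by (intro exI[of _ "rep i"] exI[of _ "rep j"] conjI refl rep_in_N32)
qed

lemma level_Suc_pairs: "{(f i, f j) | i j. level i = Suc (level j)} =
    {(f TypeA, f TypeB1), (f TypeB1, f TypeB0), (f TypeB1, f TypeC), (f TypeB1, f TypeD),
     (f TypeB0, f TypeE), (f TypeC, f TypeE), (f TypeD, f TypeE), (f TypeE, f TypeO)}"
  (is "?L = ?R")
proof (intro equalityI subsetI)
  fix e assume "e \<in> ?L"
  then obtain i j where "e = (f i, f j)" "level i = Suc (level j)" by blast
  then show "e \<in> ?R" by (cases i; cases j) simp_all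
next
  fix e assume "e \<in> ?R"
  moreover have "(f i, f j) \<in> ?L" if "level i = Suc (level j)" for i j
    using that by blast
  ultimately show "e \<in> ?L" by (elim insertE emptyE) simp_all
qed

theorem proposition7p2:
  shows "{orbit32 X | X. X \<in> (N32 :: 'k::alg_closed_field mat3_pair set)} =
      {orbit32 (pA 0 1), orbit32 (pB 0 1), orbit32 (pB 0 0), orbit32 pC, orbit32 pD,
       orbit32 (pE 0), orbit32 pO}
    \<and> card {orbit32 X | X. X \<in> (N32 :: 'k mat3_pair set)} = 7
    \<and> orbit32 (pA 0 1 :: 'k mat3_pair) =
        GL3_sweep ({pA l m | l m. m \<noteq> 0} \<union> {pA_fi l | l. True} \<union> {pA_if l | l. True})
    \<and> orbit32 (pB 0 1 :: 'k mat3_pair) =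
        GL3_sweep ({pB l m | l m. m \<noteq> 0} \<union> {pB_if m | m. m \<noteq> 0})
    \<and> orbit32 (pB 0 0 :: 'k mat3_pair) = GL3_sweep ({pB l 0 | l. True} \<union> {pB_if 0})
    \<and> orbit32 (pC :: 'k mat3_pair) = GL3_sweep {pC}
    \<and> orbit32 (pD :: 'k mat3_pair) = GL3_sweep {pD}
    \<and> orbit32 (pE 0 :: 'k mat3_pair) = GL3_sweep ({pE l | l. True} \<union> {pE_inf})
    \<and> orbit32 (pO :: 'k mat3_pair) = {pO}
    \<and> {(orbit32 X, orbit32 Y) | X Y. X \<in> (N32 :: 'k mat3_pair set) \<and> Y \<in> N32 \<and>
          minimal_degeneration X Y} =
      {(orbit32 (pA 0 1), orbit32 (pB 0 1)),
       (orbit32 (pB 0 1), orbit32 (pB 0 0)),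
       (orbit32 (pB 0 1), orbit32 pC),
       (orbit32 (pB 0 1), orbit32 pD),
       (orbit32 (pB 0 0), orbit32 (pE 0)),
       (orbit32 pC, orbit32 (pE 0)),
       (orbit32 pD, orbit32 (pE 0)),
       (orbit32 (pE 0), orbit32 pO)}"
proof -
  have inf: "infinite (UNIV :: 'k set)" by (rule infinite_UNIV_alg_closed)
  have orbits: "{orbit32 X | X. X \<in> (N32 :: 'k mat3_pair set)} =
      {orbit32 (pA 0 1), orbit32 (pB 0 1), orbit32 (pB 0 0), orbit32 pC, orbit32 pD,
       orbit32 (pE 0), orbit32 pO}"
    unfolding orbits_N32 UNIV_orbit_type by simp
  have "inj (\<lambda>i. orbit32 (rep i :: 'k mat3_pair))"
    by (simp add: inj_def orbit32_rep_eq_iff[OF inf])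
  then have "card {orbit32 X | X. X \<in> (N32 :: 'k mat3_pair set)} = card (UNIV :: orbit_type set)"
    unfolding orbits_N32 by (rule card_image)
  also have "\<dots> = 7" by (simp add: UNIV_orbit_type)
  finally have card: "card {orbit32 X | X. X \<in> (N32 :: 'k mat3_pair set)} = 7" .
  have edges: "{(orbit32 X, orbit32 Y) | X Y. X \<in> (N32 :: 'k mat3_pair set) \<and> Y \<in> N32 \<and>
          minimal_degeneration X Y} =
      {(orbit32 (pA 0 1), orbit32 (pB 0 1)),
       (orbit32 (pB 0 1), orbit32 (pB 0 0)),
       (orbit32 (pB 0 1), orbit32 pC),
       (orbit32 (pB 0 1), orbit32 pD),
       (orbit32 (pB 0 0), orbit32 (pE 0)),
       (orbit32 pC, orbit32 (pE 0)),
       (orbit32 pD, orbit32 (pE 0)),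
       (orbit32 (pE 0), orbit32 pO)}"
    unfolding minimal_degenerations_N32[OF inf] level_Suc_pairs[where f = "\<lambda>i. orbit32 (rep i)"]
    by simp
  show ?thesis
    by (intro conjI orbits card edges orbit32_A_eq orbit32_B1_eq orbit32_B0_eq orbit32_C_eq orbit32_D_eq
        orbit32_E_eq orbit32_O_eq)
qed

end
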